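(* Let $n\ge 2$ be an integer. Let $z\in\mathcal{U}(\mathcal{F}_n^1)\setminus\mathcal{N}_{\mathcal{F}_n^1}(\mathcal{D}_n^1)$ and let $a\in\mathcal{O}_n$ be such that $\lambda_z(\mathcal{D}_n)a=a\mathcal{D}_n$ (equality of subsets of $\mathcal{O}_n$). Then $a=0$. In particular, there is no unitary $u\in\mathcal{O}_n$ such that $\lambda_z(\mathcal{D}_n)=\operatorname{Ad}(u)(\mathcal{D}_n)$.
   Context: $\mathcal{O}_n$ ($n\ge 2$) is the Cuntz algebra, the unital simple $C^*$-algebra generated by isometries $S_1,\dots,S_n$ with $\sum_{i=1}^n S_iS_i^*=1$. For a word $\mu=(\mu_1,\dots,\mu_k)$ in $\{1,\dots,n\}$, $|\mu|=k$, $S_\mu=S_{\mu_1}\cdots S_{\mu_k}$ and $P_\mu=S_\mu S_\mu^*$ (for the empty word, $S_\mu=1$). $\mathcal{F}_n^k=\operatorname{span}\{S_\mu S_\nu^*:|\mu|=|\nu|=k\}\cong M_{n^k}(\mathbb{C})$. The diagonal $\mathcal{D}_n$ is the $C^*$-subalgebra of $\mathcal{O}_n$ generated by all projections $P_\mu$; it is a maximal abelian subalgebra (MASA) of $\mathcal{O}_n$, and $\mathcal{D}_n^k=\mathcal{D}_n\cap\mathcal{F}_n^k$. $\mathcal{U}(A)$ denotes the unitary group of $A$, $\mathcal{N}_B(A)=\{u\in\mathcal{U}(B):uAu^*=A\}$, and $\operatorname{Ad}(u)(x)=uxu^*$. For a unitary $u\in\mathcal{O}_n$, $\lambda_u$ is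 the unital $*$-endomorphism of $\mathcal{O}_n$ determined by $\lambda_u(S_i)=uS_i$, $i=1,\dots,n$; for $u\in\mathcal{U}(\mathcal{F}_n^1)$ it is an automorphism (a Bogolubov automorphism). For a set $X\subseteq\mathcal{O}_n$ and $a\in\mathcal{O}_n$, $Xa=\{xa:x\in X\}$ and $aX=\{ax:x\in X\}$. *)

theory Defs
  imports "HOL-Analysis.Analysis"
begin

text \<open>Unital complex C*-algebras. The inherited axiom \<open>norm 1 = 1\<close> only excludes the zero algebra.\<close>

class cstar_algebra = real_normed_algebra_1 + banach +
  fixes scaleC :: "complex \<Rightarrow> 'a \<Rightarrow> 'a"  (infixr \<open>*\<^sub>C\<close> 75)
    and star :: "'a \<Rightarrow> 'a"
  assumes scaleR_scaleC: "r *\<^sub>R x = complex_of_real r *\<^sub>C x"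
    and scaleC_add_right: "c *\<^sub>C (x + y) = c *\<^sub>C x + c *\<^sub>C y"
    and scaleC_add_left: "(c + d) *\<^sub>C x = c *\<^sub>C x + d *\<^sub>C x"
    and scaleC_scaleC: "c *\<^sub>C d *\<^sub>C x = (c * d) *\<^sub>C x"
    and scaleC_one: "1 *\<^sub>C x = x"
    and mult_scaleC_left: "(c *\<^sub>C x) * y = c *\<^sub>C (x * y)"
    and mult_scaleC_right: "x * (c *\<^sub>C y) = c *\<^sub>C (x * y)"
    and norm_scaleC: "norm (c *\<^sub>C x) = cmod c * norm x"
    and star_add: "star (x + y) = star x + star y"
    and star_scaleC: "star (c *\<^sub>C x) = cnj c *\<^sub>C star x"
    and star_mult: "star (x * y) = star y * star x"
    and star_star: "star (star x) = x"
    and norm_star_mult_self: "norm (star x * x) = (norm x)\<^sup>2"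

global_interpretation complex_vector:
  vector_space "scaleC :: complex \<Rightarrow> 'a \<Rightarrow> 'a::cstar_algebra"
  defines complex_span = complex_vector.span
  by unfold_locales (rule scaleC_add_right scaleC_add_left scaleC_scaleC scaleC_one)+

definition cstar_subalgebra :: "'a::cstar_algebra set \<Rightarrow> bool" where
  "cstar_subalgebra B \<longleftrightarrow>
     closed B \<and> 0 \<in> B \<and>
     (\<forall>x\<in>B. \<forall>y\<in>B. x + y \<in> B \<and> x * y \<in> B) \<and>
     (\<forall>c. \<forall>x\<in>B. c *\<^sub>C x \<in> B) \<and> (\<forall>x\<in>B. star x \<in> B)"

definition closed_ideal :: "'a::cstar_algebra set \<Rightarrow> bool" where
  "closed_ideal I \<longleftrightarrow>
     closed I \<and> 0 \<in> I \<and>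
     (\<forall>x\<in>I. \<forall>y\<in>I. x + y \<in> I) \<and>
     (\<forall>c. \<forall>x\<in>I. c *\<^sub>C x \<in> I) \<and>
     (\<forall>x\<in>I. \<forall>y. x * y \<in> I \<and> y * x \<in> I)"

definition unital_star_endomorphism :: "('a::cstar_algebra \<Rightarrow> 'a) \<Rightarrow> bool" where
  "unital_star_endomorphism f \<longleftrightarrow>
     f 1 = 1 \<and>
     (\<forall>x y. f (x + y) = f x + f y) \<and>
     (\<forall>c x. f (c *\<^sub>C x) = c *\<^sub>C f x) \<and>
     (\<forall>x y. f (x * y) = f x * f y) \<and>
     (\<forall>x. f (star x) = star (f x))"

definition unitaries :: "'a::cstar_algebra set \<Rightarrow> 'a set" where
  "unitaries A = {u \<in> A. star u * u = 1 \<and> u * star u = 1}"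

definition Ad :: "'a::cstar_algebra \<Rightarrow> 'a \<Rightarrow> 'a" where
  "Ad u x = u * x * star u"

definition normalizer :: "'a::cstar_algebra set \<Rightarrow> 'a set \<Rightarrow> 'a set" where
  "normalizer B A = {u \<in> unitaries B. Ad u ` A = A}"

text \<open>The whole type \<open>'a\<close> plays the role of the Cuntz algebra \<open>\<O>\<^sub>n\<close>, with generators
  \<open>S 1, \<dots>, S n\<close>; values of \<open>S\<close> outside \<open>{1..n}\<close> are irrelevant.\<close>

locale cuntz_algebra =
  fixes n :: nat and S :: "nat \<Rightarrow> 'a::cstar_algebra"
  assumes n_ge_2: "n \<ge> 2"
    and isometry: "i \<in> {1..n} \<Longrightarrow> star (S i) * S i = 1"
    and sum_range_projections: "(\<Sum>i=1..n. S i * star (S i)) = 1"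
    and generated: "cstar_subalgebra hull (S ` {1..n}) = UNIV"
    and simple: "closed_ideal (I :: 'a set) \<Longrightarrow> I = {0} \<or> I = UNIV"

definition words :: "nat \<Rightarrow> nat list set" where
  "words n = lists {1..n}"

definition S_word :: "(nat \<Rightarrow> 'a::cstar_algebra) \<Rightarrow> nat list \<Rightarrow> 'a" where
  "S_word S \<mu> = prod_list (map S \<mu>)"

definition P_word :: "(nat \<Rightarrow> 'a::cstar_algebra) \<Rightarrow> nat list \<Rightarrow> 'a" where
  "P_word S \<mu> = S_word S \<mu> * star (S_word S \<mu>)"

definition matrix_level :: "nat \<Rightarrow> (nat \<Rightarrow> 'a::cstar_algebra) \<Rightarrow> nat \<Rightarrow> 'a set"  (\<open>\<F>\<close>) where
  "\<F> n S k = complex_span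
     {S_word S \<mu> * star (S_word S \<nu>) | \<mu> \<nu>.
        \<mu> \<in> words n \<and> \<nu> \<in> words n \<and> length \<mu> = k \<and> length \<nu> = k}"

definition diagonal :: "nat \<Rightarrow> (nat \<Rightarrow> 'a::cstar_algebra) \<Rightarrow> 'a set"  (\<open>\<D>\<close>) where
  "\<D> n S = cstar_subalgebra hull (P_word S ` words n)"

definition diagonal_level :: "nat \<Rightarrow> (nat \<Rightarrow> 'a::cstar_algebra) \<Rightarrow> nat \<Rightarrow> 'a set" where
  "diagonal_level n S k = \<D> n S \<inter> \<F> n S k"

text \<open>\<open>is_cuntz_endomorphism n S u f\<close> says that \<open>f\<close> is \<open>\<lambda>\<^sub>u\<close>. For unitary \<open>u\<close> such an \<open>f\<close> exists by
  Cuntz's theorem, and it is unique because the \<open>S i\<close> generate the algebra and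
  *-homomorphisms between C*-algebras are continuous.\<close>

definition is_cuntz_endomorphism ::
    "nat \<Rightarrow> (nat \<Rightarrow> 'a::cstar_algebra) \<Rightarrow> 'a \<Rightarrow> ('a \<Rightarrow> 'a) \<Rightarrow> bool" where
  "is_cuntz_endomorphism n S u f \<longleftrightarrow>
     unital_star_endomorphism f \<and> (\<forall>i\<in>{1..n}. f (S i) = u * S i)"

end

theory Submission
  imports Defs
begin

text \<open>Since \<open>z\<close> is not monomial, some row \<open>j\<close> of its matrix \<open>Z\<close> has all entries of modulus less
  than 1. Put \<open>T i = z * S i\<close> and let \<open>Q\<^sub>\<mu> = T\<^sub>\<mu> T\<^sub>\<mu>\<^sup>*\<close> be the image of \<open>P\<^sub>\<mu>\<close> under \<open>\<lambda>\<^sub>z\<close>. Fix a word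
  \<open>\<nu>\<close> and consider the elements \<open>v\<^sub>k = S\<^sub>\<nu> S\<^sub>j\<^sup>k\<close>.

  On the one hand, \<open>T\<^sub>\<mu>\<^sup>* S\<^sub>j\<^sup>k\<close> decays geometrically in \<open>|\<mu>| \<le> k\<close>, uniformly in \<open>\<mu>\<close>, so for every \<open>x\<close>
  the norm of \<open>Q\<^sub>\<mu> x v\<^sub>k\<close> becomes small for long \<open>\<mu>\<close> and \<open>k\<close> large depending on \<open>\<mu>\<close>. On the other
  hand, if \<open>Q\<^sub>\<mu> a = a d\<close> with \<open>d \<in> \<D>\<^sub>n\<close>, then \<open>d v\<^sub>k - c v\<^sub>k \<longlongrightarrow> 0\<close> for a scalar \<open>c\<close>, so \<open>Q\<^sub>\<mu>\<close> acts on
  \<open>a v\<^sub>k\<close> asymptotically as \<open>c\<close>, which has to be 0 or 1 unless \<open>a v\<^sub>k \<longlongrightarrow> 0\<close>. As the \<open>Q\<^sub>\<mu>\<close> of a given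
  length sum to 1, some \<open>c\<close> is 1, and then \<open>Q\<^sub>\<mu> a v\<^sub>k\<close> is not small. Hence \<open>a v\<^sub>k \<longlongrightarrow> 0\<close> for every
  \<open>\<nu>\<close>; the elements \<open>a\<close> with this property form a proper closed ideal, which is zero by
  simplicity.\<close>

section \<open>C*-algebra preliminaries, obtained without spectral theory or the order on positive
  elements\<close>

lemmas scaleC_simps =
  complex_vector.scale_zero_left complex_vector.scale_zero_right
  complex_vector.scale_minus_left complex_vector.scale_minus_right
  scaleC_one scaleC_scaleC mult_scaleC_left mult_scaleC_right

lemma star_0 [simp]: "star (0::'a::cstar_algebra) = 0"
  using star_add[of "0::'a" 0] by simp

lemma star_1 [simp]: "star (1::'a::cstar_algebra) = 1"
  by (metis mult_1 mult_1_right star_mult star_star)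

lemma star_minus: "star (- x) = - star (x::'a::cstar_algebra)"
  by (metis add_eq_0_iff star_0 star_add add.right_inverse)

lemma star_diff: "star (x - y) = star x - star (y::'a::cstar_algebra)"
  using star_add[of x "- y"] by (simp add: star_minus)

lemma star_scaleR: "star (r *\<^sub>R x) = r *\<^sub>R star (x::'a::cstar_algebra)"
  by (simp add: scaleR_scaleC star_scaleC)

lemma norm_star [simp]: "norm (star x) = norm (x::'a::cstar_algebra)"
proof -
  have le: "norm y \<le> norm (star y)" for y :: 'a
  proof (cases "norm y = 0")
    case False
    have "norm y * norm y \<le> norm (star y) * norm y"
      using norm_star_mult_self[of y] norm_mult_ineq[of "star y" y]
      by (simp add: power2_eq_square)
    then show ?thesis
      using False by (simp add: mult_le_cancel_right)
  qed simp
  show ?thesis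
    using le[of x] le[of "star x"] by (simp add: star_star)
qed

lemma star_mult_self_eq_0: "star x * x = 0 \<Longrightarrow> x = (0::'a::cstar_algebra)"
  using norm_star_mult_self[of x] by simp

lemma bounded_linear_star: "bounded_linear (star :: 'a::cstar_algebra \<Rightarrow> 'a)"
  by (rule bounded_linear_intro[where K = 1]) (auto simp: star_add star_scaleR)

lemma bounded_linear_scaleC: "bounded_linear (scaleC c :: 'a::cstar_algebra \<Rightarrow> 'a)"
  by (rule bounded_linear_intro[where K = "cmod c"])
    (auto simp: scaleC_add_right scaleR_scaleC scaleC_scaleC mult.commute norm_scaleC)

lemma tendsto_scaleC_zero:
  fixes f :: "'b \<Rightarrow> 'a::cstar_algebra"
  shows "(f \<longlongrightarrow> 0) F \<Longrightarrow> ((\<lambda>x. c *\<^sub>C f x) \<longlongrightarrow> 0) F"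
  by (rule bounded_linear.tendsto_zero[OF bounded_linear_scaleC])

lemma norm_isometry:
  assumes "star v * v = (1::'a::cstar_algebra)"
  shows "norm v = 1"
  using norm_star_mult_self[of v] assms by (simp add: power2_eq_1_iff) (smt (verit) norm_ge_zero)

lemma norm_projection_le_1:
  assumes "star p = p" and "p * p = (p::'a::cstar_algebra)"
  shows "norm p \<le> 1"
proof -
  have "norm p * norm p = norm p"
    using norm_star_mult_self[of p] assms by (simp add: power2_eq_square)
  then show ?thesis by auto
qed

lemma norm_mult_le_1:
  fixes x y :: "'a::real_normed_algebra"
  assumes "norm x \<le> 1" and "norm y \<le> 1"
  shows "norm (x * y) \<le> 1"
  using norm_mult_ineq[of x y] mult_mono[OF assms] by simp

lemma norm_mult_le_left:
  fixes x y :: "'a::real_normed_algebra"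
  assumes "norm x \<le> 1"
  shows "norm (x * y) \<le> norm y"
  using norm_mult_ineq[of x y] mult_right_mono[OF assms, of "norm y"] by simp

lemma norm_mult_le_right:
  fixes x y :: "'a::real_normed_algebra"
  assumes "norm y \<le> 1"
  shows "norm (x * y) \<le> norm x"
  using norm_mult_ineq[of x y] mult_left_mono[OF assms, of "norm x"] by simp

text \<open>The hypotheses pass from \<open>h\<close> to \<open>h' = (3h + h^3)/2\<close>, because \<open>1 + h'\<close> is a weighted
  mean of the cubes of the contractions \<open>1 + h\<close>, \<open>1 + \<i>h\<close>, \<open>1 - \<i>h\<close>. As they also force
  \<open>norm h \<le> 1/2\<close>, while \<open>norm h' \<ge> (11/8) norm h\<close>, iteration gives \<open>h = 0\<close>.\<close>

lemma one_extreme_selfadjoint: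
  fixes h :: "'a::cstar_algebra"
  assumes "star h = h" and "norm (1 + h) \<le> 1" and "norm (1 - h) \<le> 1"
  shows "h = 0"
proof -
  have half: "norm h \<le> 1 / 2"
    if "norm (1 + h) \<le> 1" "norm (1 - h) \<le> 1" for h :: 'a
  proof -
    have "4 *\<^sub>R h = (1 + h) * (1 + h) - (1 - h) * (1 - h)"
      using scaleR_left_distrib[of 2 2 h] by (simp add: algebra_simps scaleR_2)
    then have "norm (4 *\<^sub>R h) \<le> 1 + 1"
      by (metis norm_triangle_le_diff add_mono norm_mult_le_1 that)
    then show ?thesis by simp
  qed
  have cube: "norm (x * x * x) \<le> 1" if "norm x \<le> 1" for x :: 'a
    using that by (intro norm_mult_le_1)
  have step: "norm (1 + ((3/2) *\<^sub>R h + (1/2) *\<^sub>R (h * h * h))) \<le> 1"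
    if h: "star h = h" "norm (1 + h) \<le> 1" "norm (1 - h) \<le> 1" for h :: 'a
  proof -
    define k where "k = \<i> *\<^sub>C h"
    have k2: "k * k = - (h * h)"
      by (simp add: k_def scaleC_simps)
    have sk: "star (1 + k) = 1 - k"
      by (simp add: k_def star_add star_scaleC h scaleC_simps)
    \<comment> \<open>As \<open>h\<close> is self-adjoint, \<open>(1 - k) * (1 + k)\<close> is
      \<open>star (1 + k) * (1 + k)\<close>. It equals the mean of the squares of the contractions
      \<open>1 + h\<close> and \<open>1 - h\<close>, and the C*-identity turns its bound into one
      for \<open>1 + k\<close>.\<close>
    have "2 *\<^sub>R ((1 - k) * (1 + k)) = (1 + h) * (1 + h) + (1 - h) * (1 - h)"
      by (simp add: algebra_simps k2 scaleR_2)
    then have "norm (2 *\<^sub>R ((1 - k) * (1 + k))) \<le> 1 + 1"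
      by (metis norm_triangle_le add_mono norm_mult_le_1 h(2,3))
    then have "(norm (1 + k))\<^sup>2 \<le> 1"
      using norm_star_mult_self[of "1 + k"] by (simp add: sk)
    then have k1: "norm (1 + k) \<le> 1"
      by (simp add: power_le_one_iff)
    then have k1': "norm (1 - k) \<le> 1"
      using norm_star[of "1 + k"] by (simp add: sk)
    have cubes: "(1 + k) * (1 + k) * (1 + k) + (1 - k) * (1 - k) * (1 - k) =
        1 + 1 - (h * h + h * h + h * h + h * h + h * h + h * h)"
    proof -
      have "(1 + k) * (1 + k) * (1 + k) + (1 - k) * (1 - k) * (1 - k) =
          1 + 1 + (k * k + k * k + k * k + k * k + k * k + k * k)"
        by (simp only: distrib_left distrib_right left_diff_distrib right_diff_distrib
            mult_1 mult_1_right mult.assoc) simp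
      then show ?thesis by (simp add: k2)
    qed
    \<comment> \<open>The cubes of \<open>1 + k\<close> and \<open>1 - k\<close> serve to cancel the
      quadratic term of twice the cube of \<open>1 + h\<close>. Numerals are split into sums of 1 so
      that both sides expand into the same monomials.\<close>
    have "4 *\<^sub>R (1 + ((3/2) *\<^sub>R h + (1/2) *\<^sub>R (h * h * h))) =
        4 *\<^sub>R 1 + (6 *\<^sub>R h + 2 *\<^sub>R (h * h * h))"
      by (simp add: scaleR_right_distrib)
    also have "\<dots> = (1 + 1 + 1 + 1) *\<^sub>R 1 +
        ((1 + 1 + 1 + 1 + 1 + 1) *\<^sub>R h + (1 + 1) *\<^sub>R (h * h * h))"
      by simp
    also have "\<dots> =
        (1 + h) * (1 + h) * (1 + h) + (1 + h) * (1 + h) * (1 + h)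
        + ((1 + k) * (1 + k) * (1 + k) + (1 - k) * (1 - k) * (1 - k))"
      unfolding cubes
      by (simp only: distrib_left distrib_right scaleR_left_distrib scaleR_one
          mult_1 mult_1_right mult.assoc) simp
    also have "norm \<dots> \<le> (1 + 1) + (1 + 1)"
      by (intro norm_triangle_mono cube h(2) k1 k1')
    finally show ?thesis by simp
  qed
  have bound: "norm h \<le> (1/2) * (8/11) ^ m"
    if "star h = h" "norm (1 + h) \<le> 1" "norm (1 - h) \<le> 1" for m and h :: 'a
    using that
  proof (induction m arbitrary: h)
    case 0
    then show ?case using half by simp
  next
    case (Suc m)
    define h' where "h' = (3/2) *\<^sub>R h + (1/2) *\<^sub>R (h * h * h)"
    have "norm (1 + h') \<le> 1"
      unfolding h'_def using step Suc.prems by blast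
    \<comment> \<open>\<open>h'\<close> is an odd polynomial in \<open>h\<close>, so the case of
      \<open>- h\<close> supplies this bound.\<close>
    moreover have "norm (1 - h') \<le> 1"
      using step[of "- h"] Suc.prems by (simp add: h'_def star_minus algebra_simps)
    moreover have "star h' = h'"
      by (simp add: h'_def star_add star_scaleR star_mult Suc.prems(1) mult.assoc)
    ultimately have 1: "norm h' \<le> (1/2) * (8/11) ^ m"
      using Suc.IH by blast
    \<comment> \<open>The cubic term of \<open>h'\<close> has norm at most 1/8 of
      \<open>norm h\<close>; what remains of the factor 3/2 is 11/8.\<close>
    have "norm (h * h * h) \<le> norm h * norm h * norm h"
      by (meson norm_mult_ineq mult_right_mono norm_ge_zero order_trans)
    also have "\<dots> \<le> (1/2) * (1/2) * norm h"
      using half[OF Suc.prems(2,3)] by (intro mult_right_mono mult_mono) auto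
    finally have 2: "norm (h * h * h) \<le> (1/4) * norm h" by simp
    have "(3/2) *\<^sub>R h = h' - (1/2) *\<^sub>R (h * h * h)"
      by (simp add: h'_def)
    then have "(3/2) * norm h \<le> norm h' + (1/2) * norm (h * h * h)"
      using norm_triangle_ineq4[of h' "(1/2) *\<^sub>R (h * h * h)"]
      by (metis abs_of_pos norm_scaleR half_gt_zero zero_less_one zero_less_divide_iff zero_less_numeral)
    then show ?case using 1 2 by simp
  qed
  have "(\<lambda>m. (1/2) * (8/11::real) ^ m) \<longlonglongrightarrow> (1/2) * 0"
    by (intro tendsto_mult tendsto_const LIMSEQ_power_zero) simp
  then have "norm h \<le> (1/2) * 0"
    by (rule LIMSEQ_le_const) (use bound[OF assms] in blast)
  then show ?thesis by simp
qed

text \<open>The element is the compression by \<open>v\<close> of the projection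
  \<open>1 - u * star u\<close>.\<close>

lemma star_mult_star_contraction:
  fixes u v :: "'a::cstar_algebra"
  assumes "star u * u = 1" and "star v * v = 1"
  shows "norm (1 - star (star u * v) * (star u * v)) \<le> 1"
proof -
  let ?p = "1 - u * star u"
  have "u * star u * (u * star u) = u * (star u * u) * star u"
    by (simp only: mult.assoc)
  then have "norm ?p \<le> 1"
    by (intro norm_projection_le_1)
      (simp_all add: star_diff star_mult star_star assms algebra_simps)
  moreover have "1 - star (star u * v) * (star u * v) = star v * ?p * v"
    by (simp add: star_mult star_star assms algebra_simps)
  ultimately show ?thesis
    using norm_isometry[OF assms(2)] by (auto intro!: norm_mult_le_1)
qed

section \<open>Words in the generators\<close>

lemma S_word_simps [simp]:
  "S_word S [] = 1"
  "S_word S (i # \<mu>) = S i * S_word S \<mu>"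
  "S_word S (\<mu> @ \<nu>) = S_word S \<mu> * S_word S \<nu>"
  "S_word S (replicate k i) = S i ^ k"
  by (simp_all add: S_word_def prod_list_replicate)

lemma words_simps [simp]:
  "[] \<in> words n"
  "i # \<mu> \<in> words n \<longleftrightarrow> i \<in> {1..n} \<and> \<mu> \<in> words n"
  "\<mu> @ \<nu> \<in> words n \<longleftrightarrow> \<mu> \<in> words n \<and> \<nu> \<in> words n"
  "replicate k i \<in> words n \<longleftrightarrow> k = 0 \<or> i \<in> {1..n}"
  by (auto simp: words_def in_lists_conv_set)

section \<open>Cuntz relations and invariant subspaces\<close>

context cuntz_algebra
begin

text \<open>Compressing the sum of the range projections by \<open>S j\<close> shows that the
  elements \<open>h l\<close> with \<open>l \<noteq> j\<close> sum to 0. Positivity would make each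
  of them vanish; the contractions \<open>1 - h l\<close> take the place of positivity, and a
  multiple of \<open>h i\<close> meets the hypotheses of
  \<open>one_extreme_selfadjoint\<close>.\<close>

lemma orthogonal:
  assumes "i \<in> {1..n}" and "j \<in> {1..n}" and "i \<noteq> j"
  shows "star (S i) * S j = 0"
proof -
  define h where "h l = star (star (S l) * S j) * (star (S l) * S j)" for l
  have "(\<Sum>l=1..n. h l) = star (S j) * (\<Sum>l=1..n. S l * star (S l)) * S j"
    by (simp add: h_def star_mult star_star sum_distrib_left sum_distrib_right mult.assoc)
  also have "\<dots> = h j"
    unfolding sum_range_projections by (simp add: isometry[OF assms(2)] h_def)
  finally have sum0: "(\<Sum>l\<in>{1..n}-{j}. h l) = 0"
    using assms by (simp add: sum.remove[of _ j])
  \<comment> \<open>The remaining \<open>h l\<close> sum to \<open>- h i\<close>. So adding up the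
    \<open>N - 2\<close> contractions \<open>1 - h l\<close> over \<open>A\<close> produces
    \<open>+ h i\<close>, whereas \<open>1 - h i\<close> gives the other sign; both are padded with
    a multiple of 1 to total bound \<open>N\<close>.\<close>
  define A where "A = {1..n} - {j} - {i}"
  have "(\<Sum>l\<in>{1..n}-{j}. h l) = h i + sum h A"
    unfolding A_def using assms by (intro sum.remove) auto
  with sum0 have hi: "sum h A = - h i"
    by (metis add_eq_0_iff)
  have contr: "norm (1 - h l) \<le> 1" if "l \<in> {1..n}" for l
    unfolding h_def using that assms by (intro star_mult_star_contraction isometry)
  define N where "N = real n"
  have N: "N > 0" using n_ge_2 by (simp add: N_def)
  have cA: "real (card A) = N - 2"
    using assms n_ge_2 by (simp add: A_def N_def of_nat_diff)
  have "(\<Sum>l\<in>A. 1 - h l) = real (card A) *\<^sub>R 1 + h i"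
    by (simp add: sum_subtractf hi scaleR_conv_of_real)
  then have "N *\<^sub>R 1 + h i = 2 *\<^sub>R 1 + (\<Sum>l\<in>A. 1 - h l)"
    unfolding cA by (simp only: scaleR_left_diff_distrib) simp
  also have "norm \<dots> \<le> 2 + (\<Sum>l\<in>A. 1)"
    by (intro norm_triangle_mono sum_norm_le contr) (auto simp: A_def)
  also have "\<dots> = N"
    by (simp add: cA)
  finally have p: "norm (N *\<^sub>R 1 + h i) \<le> N" .
  have "N *\<^sub>R 1 - h i = (N - 1) *\<^sub>R 1 + (1 - h i)"
    by (simp add: algebra_simps)
  also have "norm \<dots> \<le> (N - 1) + 1"
    using contr assms n_ge_2 by (intro norm_triangle_mono) (auto simp: N_def)
  finally have m: "norm (N *\<^sub>R 1 - h i) \<le> N" by simp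
  have "inverse N *\<^sub>R h i = 0"
  proof (rule one_extreme_selfadjoint)
    show "star (inverse N *\<^sub>R h i) = inverse N *\<^sub>R h i"
      by (simp add: star_scaleR h_def star_mult star_star)
    have "norm (inverse N *\<^sub>R (N *\<^sub>R 1 + h i)) \<le> 1"
      unfolding norm_scaleR using p N by (simp add: field_simps)
    then show "norm (1 + inverse N *\<^sub>R h i) \<le> 1"
      using N by (simp add: scaleR_right_distrib)
    have "norm (inverse N *\<^sub>R (N *\<^sub>R 1 - h i)) \<le> 1"
      unfolding norm_scaleR using m N by (simp add: field_simps)
    then show "norm (1 - inverse N *\<^sub>R h i) \<le> 1"
      using N by (simp add: scaleR_right_diff_distrib)
  qed
  then have "h i = 0" using N by simp
  then show ?thesis
    unfolding h_def by (rule star_mult_self_eq_0)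
qed

lemma star_mult_generators:
  assumes "i \<in> {1..n}" and "j \<in> {1..n}"
  shows "star (S i) * S j = (if i = j then 1 else 0)"
  using assms isometry orthogonal by auto

text \<open>The elements \<open>b\<close> such that both \<open>b\<close> and \<open>star b\<close>
  map \<open>M\<close> into itself form a C*-subalgebra. It contains the generators and is therefore
  the whole algebra.\<close>

lemma left_invariant_subspace:
  assumes "closed M" and "0 \<in> M"
    and add: "\<And>x y. x \<in> M \<Longrightarrow> y \<in> M \<Longrightarrow> x + y \<in> M"
    and scale: "\<And>c x. x \<in> M \<Longrightarrow> c *\<^sub>C x \<in> M"
    and S: "\<And>i x. i \<in> {1..n} \<Longrightarrow> x \<in> M \<Longrightarrow> S i * x \<in> M"
    and star_S: "\<And>i x. i \<in> {1..n} \<Longrightarrow> x \<in> M \<Longrightarrow> star (S i) * x \<in> M"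
    and "x \<in> M"
  shows "b * x \<in> M"
proof -
  define B where "B = (\<Inter>x\<in>M. (\<lambda>b. b * x) -` M \<inter> (\<lambda>b. star b * x) -` M)"
  have "closed B"
    unfolding B_def
    by (intro closed_INT ballI closed_Int closed_vimage \<open>closed M\<close> continuous_intros
        bounded_linear.continuous_on[OF bounded_linear_star])
  then have "cstar_subalgebra B"
    using \<open>0 \<in> M\<close> add scale
    by (auto simp: cstar_subalgebra_def B_def star_add star_mult star_star star_scaleC
        distrib_right mult.assoc scaleC_simps)
  moreover have "S ` {1..n} \<subseteq> B"
    using S star_S by (auto simp: B_def)
  ultimately have "b \<in> B"
    using hull_minimal[of "S ` {1..n}" B cstar_subalgebra] generated by auto
  then show ?thesis using \<open>x \<in> M\<close> by (auto simp: B_def)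
qed

text \<open>The adjoints of the elements of \<open>M\<close> form a subspace invariant from the
  left.\<close>

lemma right_invariant_subspace:
  assumes "closed M" and "0 \<in> M"
    and "\<And>x y. x \<in> M \<Longrightarrow> y \<in> M \<Longrightarrow> x + y \<in> M"
    and "\<And>c x. x \<in> M \<Longrightarrow> c *\<^sub>C x \<in> M"
    and "\<And>i x. i \<in> {1..n} \<Longrightarrow> x \<in> M \<Longrightarrow> x * S i \<in> M"
    and "\<And>i x. i \<in> {1..n} \<Longrightarrow> x \<in> M \<Longrightarrow> x * star (S i) \<in> M"
    and "x \<in> M"
  shows "x * b \<in> M"
proof -
  have "closed (star -` M)"
    using \<open>closed M\<close>
    by (intro closed_vimage bounded_linear.continuous_on[OF bounded_linear_star continuous_on_id])
  then have "star b * star x \<in> star -` M"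
    by (rule left_invariant_subspace)
      (use assms in \<open>auto simp: star_add star_scaleC star_mult star_star\<close>)
  then show ?thesis by (simp add: star_mult star_star)
qed


lemma sum_matrix_units: "(\<Sum>i=1..n. S i * (star (S i) * x)) = x"
proof -
  have "(\<Sum>i=1..n. S i * (star (S i) * x)) = (\<Sum>i=1..n. S i * star (S i)) * x"
    by (simp only: sum_distrib_right mult.assoc)
  then show ?thesis by (simp only: sum_range_projections mult_1)
qed

section \<open>The diagonal, the first matrix level and its normalizer\<close>

lemma S_word_isometry: "\<mu> \<in> words n \<Longrightarrow> star (S_word S \<mu>) * S_word S \<mu> = 1"
proof (induction \<mu>)
  case (Cons i \<mu>)
  have "star (S_word S (i # \<mu>)) * S_word S (i # \<mu>) =
      star (S_word S \<mu>) * (star (S i) * S i) * S_word S \<mu>"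
    by (simp add: star_mult mult.assoc)
  then show ?case
    using Cons isometry[of i] by simp
qed simp

lemma norm_S_word: "\<mu> \<in> words n \<Longrightarrow> norm (S_word S \<mu>) = 1"
  by (intro norm_isometry S_word_isometry)

lemma P_word_in_diagonal: "\<mu> \<in> words n \<Longrightarrow> P_word S \<mu> \<in> \<D> n S"
  unfolding diagonal_def by (meson hull_subset image_eqI subsetD)

lemma diagonal_induct:
  assumes "cstar_subalgebra B" and "\<And>\<mu>. \<mu> \<in> words n \<Longrightarrow> P_word S \<mu> \<in> B" and "d \<in> \<D> n S"
  shows "d \<in> B"
  using hull_minimal[of "P_word S ` words n" B cstar_subalgebra] assms
  unfolding diagonal_def by auto

lemma cstar_subalgebra_diagonal: "cstar_subalgebra (\<D> n S)"
  unfolding diagonal_def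
proof (rule hull_in)
  fix \<T> :: "'a set set"
  assume *: "\<forall>B\<in>\<T>. cstar_subalgebra B"
  then have "closed (\<Inter>\<T>)"
    by (intro closed_Inter) (auto simp: cstar_subalgebra_def)
  then show "cstar_subalgebra (\<Inter>\<T>)"
    using * by (auto simp: cstar_subalgebra_def)
qed

text \<open>For a nonempty word both products are \<open>P_word S \<mu>\<close> if its first letter
  is \<open>i\<close>, and 0 otherwise.\<close>

lemma P_word_commute_generator:
  assumes "i \<in> {1..n}" and "\<mu> \<in> words n"
  shows "P_word S \<mu> * (S i * star (S i)) = S i * star (S i) * P_word S \<mu>"
proof (cases \<mu>)
  case (Cons l \<nu>)
  then have l: "l \<in> {1..n}" using assms by simp
  have l1: "star (S l) * (S i * x) = (if l = i then x else 0)" for x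
    using star_mult_generators[OF l assms(1)] by (simp flip: mult.assoc)
  have l2: "star (S i) * (S l * x) = (if l = i then x else 0)" for x
    using star_mult_generators[OF assms(1) l] by (auto simp flip: mult.assoc)
  show ?thesis
    by (simp add: Cons P_word_def star_mult mult.assoc l1 l2)
qed (simp add: P_word_def)

text \<open>The commutant of a self-adjoint element is a C*-subalgebra, so it suffices to look at
  the generating projections.\<close>

lemma diagonal_commute_generator:
  assumes "i \<in> {1..n}" and "d \<in> \<D> n S"
  shows "d * (S i * star (S i)) = S i * star (S i) * d"
proof -
  let ?p = "S i * star (S i)"
  let ?B = "{d. d * ?p = ?p * d}"
  have sp: "star ?p = ?p" by (simp add: star_mult star_star)
  have "star x * ?p = ?p * star x" if "x * ?p = ?p * x" for x
    using arg_cong[OF that, of star] by (simp add: star_mult[of _ ?p] star_mult[of ?p] sp)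
  moreover have "x * y * ?p = ?p * (x * y)" if "x * ?p = ?p * x" "y * ?p = ?p * y" for x y
    by (metis that mult.assoc)
  moreover have "closed ?B"
    by (intro closed_Collect_eq continuous_intros)
  ultimately have "cstar_subalgebra ?B"
    by (auto simp: cstar_subalgebra_def distrib_left distrib_right scaleC_simps)
  then have "d \<in> ?B"
    by (rule diagonal_induct) (use assms P_word_commute_generator in auto)
  then show ?thesis by simp
qed

text \<open>The scalar is the \<open>(i, l)\<close> entry of \<open>x\<close> as an \<open>n\<close>
  by \<open>n\<close> matrix: the compression of a matrix unit is 0 or 1, and the matrix units
  span.\<close>

lemma matrix_level_1_coefficient:
  assumes "x \<in> \<F> n S 1" and "i \<in> {1..n}" and "l \<in> {1..n}"
  shows "\<exists>c. star (S i) * x * S l = c *\<^sub>C 1"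
  using assms(1) unfolding matrix_level_def
proof (induction rule: complex_vector.span_induct_alt)
  case base
  then show ?case by (metis complex_vector.scale_zero_left mult_zero_left mult_zero_right)
next
  case (step c x y)
  then obtain p q where "x = S p * star (S q)" "p \<in> {1..n}" "q \<in> {1..n}"
    by (auto simp: length_Suc_conv)
  then have "star (S i) * x * S l = (star (S i) * S p) * (star (S q) * S l)"
    by (simp add: mult.assoc)
  also have "\<dots> = (if i = p \<and> q = l then 1 else 0) *\<^sub>C 1"
    using assms \<open>p \<in> {1..n}\<close> \<open>q \<in> {1..n}\<close> by (simp add: star_mult_generators scaleC_simps del: atLeastAtMost_iff)
  finally obtain d where "star (S i) * x * S l = d *\<^sub>C 1" by blast
  moreover obtain e where "star (S i) * y * S l = e *\<^sub>C 1" using step by blast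
  ultimately have "star (S i) * (c *\<^sub>C x + y) * S l = (c * d + e) *\<^sub>C 1"
    by (simp add: distrib_left distrib_right scaleC_add_left scaleC_simps)
  then show ?case by blast
qed

text \<open>Commuting with the range projection of \<open>S i\<close> gives
  \<open>x * S i = S i * (star (S i) * x * S i)\<close>, and the compression is a scalar.
  Conversely, the eigenvalues recover \<open>x\<close> as a combination of the projections of
  one-letter words.\<close>

lemma diagonal_level_1:
  "diagonal_level n S 1 = {x. \<exists>c. \<forall>i\<in>{1..n}. x * S i = c i *\<^sub>C S i}"
proof (intro equalityI subsetI CollectI)
  fix x assume "x \<in> diagonal_level n S 1"
  then have x: "x \<in> \<D> n S" "x \<in> \<F> n S 1" by (auto simp: diagonal_level_def)
  have "\<exists>c. x * S i = c *\<^sub>C S i" if i: "i \<in> {1..n}" for i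
  proof -
    have "x * S i = x * (S i * star (S i)) * S i"
      by (simp add: isometry[OF i] mult.assoc)
    also have "\<dots> = S i * (star (S i) * x * S i)"
      by (simp add: diagonal_commute_generator[OF i x(1)] mult.assoc)
    finally show ?thesis
      using matrix_level_1_coefficient[OF x(2) i i] by (auto simp: scaleC_simps)
  qed
  then show "\<exists>c. \<forall>i\<in>{1..n}. x * S i = c i *\<^sub>C S i"
    by metis
next
  fix x assume "x \<in> {x. \<exists>c. \<forall>i\<in>{1..n}. x * S i = c i *\<^sub>C S i}"
  then obtain c where c: "\<forall>i\<in>{1..n}. x * S i = c i *\<^sub>C S i" by blast
  have "x = (\<Sum>i=1..n. x * (S i * star (S i)))"
    by (simp only: sum_range_projections mult_1_right flip: sum_distrib_left)
  also have "\<dots> = (\<Sum>i=1..n. c i *\<^sub>C (S i * star (S i)))"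
    using c by (intro sum.cong) (simp_all add: scaleC_simps flip: mult.assoc)
  finally have x: "x = (\<Sum>i=1..n. c i *\<^sub>C (S i * star (S i)))" .
  have sum_D: "sum f A \<in> \<D> n S" if "\<And>i. i \<in> A \<Longrightarrow> f i \<in> \<D> n S" for f and A :: "nat set"
    using that cstar_subalgebra_diagonal
    by (induction A rule: infinite_finite_induct) (auto simp: cstar_subalgebra_def)
  have "x \<in> \<D> n S"
    unfolding x
  proof (rule sum_D)
    fix i assume "i \<in> {1..n}"
    then show "c i *\<^sub>C (S i * star (S i)) \<in> \<D> n S"
      using P_word_in_diagonal[of "[i]"] cstar_subalgebra_diagonal
      by (auto simp: cstar_subalgebra_def P_word_def)
  qed
  moreover have "x \<in> \<F> n S 1"
    unfolding x matrix_level_def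
  proof (intro complex_vector.span_sum complex_vector.span_scale complex_vector.span_base CollectI)
    fix i assume "i \<in> {1..n}"
    then show "\<exists>\<mu> \<nu>. S i * star (S i) = S_word S \<mu> * star (S_word S \<nu>) \<and>
        \<mu> \<in> words n \<and> \<nu> \<in> words n \<and> length \<mu> = 1 \<and> length \<nu> = 1"
      by (intro exI[of _ "[i]"]) simp
  qed
  ultimately show "x \<in> diagonal_level n S 1"
    by (simp add: diagonal_level_def)
qed

text \<open>In terms of the eigenvalues \<open>c\<close> of a diagonal element on the
  \<open>S i\<close>, conjugation by \<open>z\<close> replaces \<open>c\<close> by its composition
  with \<sigma>, which is a permutation.\<close>

lemma normalizer_if_monomial:
  assumes z: "z \<in> unitaries (\<F> n S 1)"
    and \<sigma>: "\<And>i. i \<in> {1..n} \<Longrightarrow> \<sigma> i \<in> {1..n}"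
    and star_z: "\<And>i. i \<in> {1..n} \<Longrightarrow> star z * S i = e i *\<^sub>C S (\<sigma> i)"
  shows "z \<in> normalizer (\<F> n S 1) (diagonal_level n S 1)"
proof -
  have zz: "star z * z = 1" "z * star z = 1"
    using z by (auto simp: unitaries_def)
  have z_S: "e i *\<^sub>C (z * S (\<sigma> i)) = S i" if "i \<in> {1..n}" for i
  proof -
    have "z * (star z * S i) = S i"
      by (simp add: zz flip: mult.assoc)
    then show ?thesis
      using star_z[OF that] by (simp add: scaleC_simps)
  qed
  \<comment> \<open>If \<sigma> identified \<open>i\<close> and \<open>l\<close>, then
    \<open>S i\<close> and \<open>S l\<close> would be multiples of one element; as they are
    orthogonal isometries, this forces \<open>e i = 0\<close> and then
    \<open>S i = 0\<close>.\<close>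
  have "inj_on \<sigma> {1..n}"
  proof (intro inj_onI, rule ccontr)
    fix i l assume il: "i \<in> {1..n}" "l \<in> {1..n}" "\<sigma> i = \<sigma> l" "i \<noteq> l"
    have "e i *\<^sub>C (star (S l) * S l) = star (S l) * (e i *\<^sub>C e l *\<^sub>C (z * S (\<sigma> l)))"
      using z_S[OF il(2)] by (simp add: scaleC_simps)
    also have "\<dots> = e l *\<^sub>C (star (S l) * (e i *\<^sub>C (z * S (\<sigma> i))))"
      by (simp add: scaleC_simps il mult.commute)
    also have "\<dots> = 0"
      using z_S[OF il(1)] orthogonal[of l i] il by (simp add: scaleC_simps)
    finally have "e i = 0"
      by (simp add: isometry[OF il(2)])
    then have "S i = 0"
      using z_S[OF il(1)] by simp
    then show False
      using isometry[OF il(1)] by simp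
  qed
  have Ad_S: "Ad z x * S i = c (\<sigma> i) *\<^sub>C S i"
    if "i \<in> {1..n}" and x: "\<forall>l\<in>{1..n}. x * S l = c l *\<^sub>C S l" for x c i
  proof -
    have "Ad z x * S i = z * (x * (star z * S i))"
      by (simp add: Ad_def mult.assoc)
    also have "\<dots> = c (\<sigma> i) *\<^sub>C e i *\<^sub>C (z * S (\<sigma> i))"
      using star_z[OF that(1)] x \<sigma>[OF that(1)] by (simp add: scaleC_simps mult.commute)
    finally show ?thesis
      using z_S[OF that(1)] by simp
  qed
  have "Ad z ` diagonal_level n S 1 = diagonal_level n S 1"
  proof (intro equalityI subsetI)
    fix y assume "y \<in> Ad z ` diagonal_level n S 1"
    then obtain x c where "y = Ad z x" "\<forall>i\<in>{1..n}. x * S i = c i *\<^sub>C S i"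
      unfolding diagonal_level_1 by blast
    then have "\<forall>i\<in>{1..n}. y * S i = c (\<sigma> i) *\<^sub>C S i"
      using Ad_S by blast
    then show "y \<in> diagonal_level n S 1"
      unfolding diagonal_level_1 by (intro CollectI exI[of _ "\<lambda>i. c (\<sigma> i)"])
  next
    fix y assume "y \<in> diagonal_level n S 1"
    then obtain c where c: "\<forall>i\<in>{1..n}. y * S i = c i *\<^sub>C S i"
      unfolding diagonal_level_1 by blast
    define x where "x = star z * y * z"
    have "y = Ad z x"
    proof -
      have "Ad z x = (z * star z) * y * (z * star z)"
        by (simp only: Ad_def x_def mult.assoc)
      then show ?thesis by (simp add: zz)
    qed
    \<comment> \<open>The eigenvalue of \<open>x\<close> on \<open>S l\<close> is that of
      \<open>y\<close> at the index which \<sigma> sends to \<open>l\<close>.\<close>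
    moreover have "x \<in> diagonal_level n S 1"
      unfolding diagonal_level_1
    proof (intro CollectI exI ballI)
      fix l assume "l \<in> {1..n}"
      moreover have "\<sigma> ` {1..n} = {1..n}"
        using \<open>inj_on \<sigma> {1..n}\<close> \<sigma> by (intro endo_inj_surj) auto
      ultimately obtain i where i: "i \<in> {1..n}" "l = \<sigma> i" by blast
      have "e i \<noteq> 0"
        using z_S[OF i(1)] isometry[OF i(1)] by auto
      then have zl: "z * S l = inverse (e i) *\<^sub>C S i"
        using arg_cong[OF z_S[OF i(1)], of "scaleC (inverse (e i))"] i by (simp add: scaleC_simps)
      have "x * S l = star z * (y * (z * S l))"
        by (simp add: x_def mult.assoc)
      also have "\<dots> = c i *\<^sub>C S l"
        unfolding zl using bspec[OF c i(1)] i(2) star_z[OF i(1)] \<open>e i \<noteq> 0\<close>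
        by (simp add: scaleC_simps)
      finally show "x * S l = c (inv_into {1..n} \<sigma> l) *\<^sub>C S l"
        using \<open>inj_on \<sigma> {1..n}\<close> i by simp
    qed
    ultimately show "y \<in> Ad z ` diagonal_level n S 1" by blast
  qed
  then show ?thesis using z by (simp add: normalizer_def)
qed


section \<open>Asymptotics along eventually constant words\<close>

text \<open>Every element of \<open>\<D>\<^sub>n\<close> acts on the vectors along an infinite word asymptotically as its value
  at the character of \<open>\<D>\<^sub>n\<close> given by that word; here the word is \<open>\<nu>jjj\<dots>\<close>.\<close>

lemma diagonal_asymptotic_character:
  assumes "\<nu> \<in> words n" and "j \<in> {1..n}" and "d \<in> \<D> n S"
  shows "\<exists>c. (\<lambda>k. d * (S_word S \<nu> * S j ^ k) - c *\<^sub>C (S_word S \<nu> * S j ^ k)) \<longlonglongrightarrow> 0"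
proof -
  define v where "v k = S_word S \<nu> * S j ^ k" for k
  define A where "A = {d. \<exists>c. (\<lambda>k. d * v k - c *\<^sub>C v k) \<longlonglongrightarrow> 0}"
  have v_word: "v k = S_word S (\<nu> @ replicate k j)" for k
    by (simp add: v_def)
  have norm_v: "norm (v k) = 1" for k
    unfolding v_word using assms by (intro norm_S_word) simp
  have A_add: "x + y \<in> A" if "x \<in> A" "y \<in> A" for x y
  proof -
    obtain c where "(\<lambda>k. x * v k - c *\<^sub>C v k) \<longlonglongrightarrow> 0"
      using \<open>x \<in> A\<close> unfolding A_def by blast
    moreover obtain d where "(\<lambda>k. y * v k - d *\<^sub>C v k) \<longlonglongrightarrow> 0"
      using \<open>y \<in> A\<close> unfolding A_def by blast
    ultimately have "(\<lambda>k. (x * v k - c *\<^sub>C v k) + (y * v k - d *\<^sub>C v k)) \<longlonglongrightarrow> 0 + 0"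
      by (rule tendsto_add)
    then have "(\<lambda>k. (x + y) * v k - (c + d) *\<^sub>C v k) \<longlonglongrightarrow> 0"
      by (simp add: distrib_right scaleC_add_left algebra_simps)
    then show ?thesis by (auto simp: A_def)
  qed
  have A_mult: "x * y \<in> A" if "x \<in> A" "y \<in> A" for x y
  proof -
    obtain c where "(\<lambda>k. x * v k - c *\<^sub>C v k) \<longlonglongrightarrow> 0"
      using \<open>x \<in> A\<close> unfolding A_def by blast
    moreover obtain d where "(\<lambda>k. y * v k - d *\<^sub>C v k) \<longlonglongrightarrow> 0"
      using \<open>y \<in> A\<close> unfolding A_def by blast
    ultimately have "(\<lambda>k. x * (y * v k - d *\<^sub>C v k) + d *\<^sub>C (x * v k - c *\<^sub>C v k)) \<longlonglongrightarrow> x * 0 + 0"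
      by (intro tendsto_add tendsto_mult tendsto_const tendsto_scaleC_zero)
    then have "(\<lambda>k. x * y * v k - (d * c) *\<^sub>C v k) \<longlonglongrightarrow> 0"
      by (simp add: right_diff_distrib complex_vector.scale_right_diff_distrib scaleC_simps mult.assoc)
    then show ?thesis by (auto simp: A_def)
  qed
  have A_scale: "c *\<^sub>C x \<in> A" if x: "x \<in> A" for c x
  proof -
    obtain d where "(\<lambda>k. x * v k - d *\<^sub>C v k) \<longlonglongrightarrow> 0"
      using x by (auto simp: A_def)
    then have "(\<lambda>k. c *\<^sub>C (x * v k - d *\<^sub>C v k)) \<longlonglongrightarrow> 0"
      by (rule tendsto_scaleC_zero)
    then have "(\<lambda>k. c *\<^sub>C x * v k - (c * d) *\<^sub>C v k) \<longlonglongrightarrow> 0"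
      by (simp add: complex_vector.scale_right_diff_distrib scaleC_simps)
    then show ?thesis by (auto simp: A_def)
  qed
  have A_0: "0 \<in> A"
    by (auto simp: A_def intro!: exI[of _ 0] simp: scaleC_simps)
  have "closed A"
    unfolding closed_sequential_limits
  proof (intro allI impI, elim conjE)
    fix X x assume X: "\<forall>m. X m \<in> A" and lim: "X \<longlonglongrightarrow> x"
    then obtain c where c: "\<And>m. (\<lambda>k. X m * v k - c m *\<^sub>C v k) \<longlonglongrightarrow> 0"
      unfolding A_def mem_Collect_eq by metis
    \<comment> \<open>Because \<open>norm (v k) = 1\<close>, the asymptotic eigenvalue depends
      contractively on the element. Hence the eigenvalues along a convergent sequence converge, and
      their limit serves the limit element.\<close>
    have dist_c: "dist (c m) (c l) \<le> dist (X m) (X l)" for m l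
    proof (rule field_le_epsilon)
      fix e :: real assume "e > 0"
      then have "\<forall>\<^sub>F k in sequentially. norm (X m * v k - c m *\<^sub>C v k) < e/2 \<and>
          norm (X l * v k - c l *\<^sub>C v k) < e/2"
        using tendstoD[OF c[of m], of "e/2"] tendstoD[OF c[of l], of "e/2"]
        by (auto intro: eventually_conj)
      then obtain k where k: "norm (X m * v k - c m *\<^sub>C v k) < e/2"
          "norm (X l * v k - c l *\<^sub>C v k) < e/2"
        using eventually_happens trivial_limit_sequentially by blast
      have "cmod (c m - c l) = norm ((c m - c l) *\<^sub>C v k)"
        by (simp add: norm_scaleC norm_v)
      also have "(c m - c l) *\<^sub>C v k = (X m - X l) * v k
          + ((X l * v k - c l *\<^sub>C v k) - (X m * v k - c m *\<^sub>C v k))"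
        by (simp add: algebra_simps complex_vector.scale_left_diff_distrib)
      also have "norm \<dots> \<le> norm (X m - X l) + (e/2 + e/2)"
        using k norm_v[of k]
        by (intro norm_triangle_mono norm_mult_le_right order_trans[OF norm_triangle_ineq4 add_mono])
          auto
      finally show "dist (c m) (c l) \<le> dist (X m) (X l) + e"
        by (simp add: dist_norm)
    qed
    have "Cauchy X"
      using lim by (rule LIMSEQ_imp_Cauchy)
    then have "Cauchy c"
      unfolding Cauchy_def using dist_c by (meson le_less_trans)
    then obtain c' where c': "c \<longlonglongrightarrow> c'"
      using Cauchy_convergent convergent_def by blast
    have "(\<lambda>k. x * v k - c' *\<^sub>C v k) \<longlonglongrightarrow> 0"
    proof (rule tendstoI)
      fix e :: real assume "e > 0"
      then have "\<forall>\<^sub>F m in sequentially. dist (X m) x < e/3 \<and> dist (c m) c' < e/3"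
        using tendstoD[OF lim, of "e/3"] tendstoD[OF c', of "e/3"] by (auto intro: eventually_conj)
      then obtain m where m: "dist (X m) x < e/3" "dist (c m) c' < e/3"
        using eventually_happens trivial_limit_sequentially by blast
      have "\<forall>\<^sub>F k in sequentially. norm (X m * v k - c m *\<^sub>C v k) < e/3"
        using tendstoD[OF c[of m], of "e/3"] \<open>e > 0\<close> by simp
      then show "\<forall>\<^sub>F k in sequentially. dist (x * v k - c' *\<^sub>C v k) 0 < e"
      proof eventually_elim
        case (elim k)
        have "x * v k - c' *\<^sub>C v k = (X m * v k - c m *\<^sub>C v k)
            + ((c m - c') *\<^sub>C v k - (X m - x) * v k)"
          by (simp add: algebra_simps complex_vector.scale_left_diff_distrib)
        also have "norm \<dots> \<le> norm (X m * v k - c m *\<^sub>C v k) + (cmod (c m - c') + norm (X m - x))"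
          using norm_v[of k] norm_mult_le_right[of "v k" "X m - x"]
          by (intro norm_triangle_mono order_refl order_trans[OF norm_triangle_ineq4 add_mono])
            (auto simp: norm_scaleC)
        also have "\<dots> < e/3 + (e/3 + e/3)"
          using elim m by (simp add: dist_norm)
        finally show ?case by simp
      qed
    qed
    then show "x \<in> A" by (auto simp: A_def)
  qed
  \<comment> \<open>On words at least as long as \<mu>, this projection tests for the prefix
    \<mu>.\<close>
  have P_mult: "P_word S \<mu> * S_word S \<rho> = (if take (length \<mu>) \<rho> = \<mu> then S_word S \<rho> else 0)"
    if "length \<mu> \<le> length \<rho>" "\<mu> \<in> words n" "\<rho> \<in> words n" for \<mu> \<rho>
    using that
  proof (induction \<mu> arbitrary: \<rho>)
    case Nil
    then show ?case by (simp add: P_word_def)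
  next
    case (Cons i \<mu>)
    then obtain l \<tau> where \<rho>: "\<rho> = l # \<tau>" by (cases \<rho>) auto
    have "P_word S (i # \<mu>) * S_word S \<rho> =
        S i * (S_word S \<mu> * star (S_word S \<mu>) * ((star (S i) * S l) * S_word S \<tau>))"
      by (simp add: \<rho> P_word_def star_mult mult.assoc)
    also have "\<dots> = (if i = l then S i * (P_word S \<mu> * S_word S \<tau>) else 0)"
      using Cons.prems star_mult_generators[of i l] by (simp add: \<rho> P_word_def)
    finally show ?case
      using Cons.IH[of \<tau>] Cons.prems by (auto simp: \<rho>)
  qed
  have A_P: "P_word S \<mu> \<in> A" if "\<mu> \<in> words n" for \<mu>
  proof -
    \<comment> \<open>From \<open>k = length \<mu>\<close> on, the prefix being tested no longer
      changes, so the eigenvalue is attained exactly.\<close>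
    define c :: complex
      where "c = (if take (length \<mu>) (\<nu> @ replicate (length \<mu>) j) = \<mu> then 1 else 0)"
    have "P_word S \<mu> * v k = c *\<^sub>C v k" if k: "k \<ge> length \<mu>" for k
    proof -
      have "take (length \<mu>) (\<nu> @ replicate k j) = take (length \<mu>) (\<nu> @ replicate (length \<mu>) j)"
        using k by (simp add: min_def)
      moreover have "\<nu> @ replicate k j \<in> words n"
        using assms by simp
      ultimately show ?thesis
        using P_mult[of \<mu> "\<nu> @ replicate k j"] k \<open>\<mu> \<in> words n\<close>
        unfolding v_word c_def by (simp add: scaleC_simps)
    qed
    then have "\<forall>\<^sub>F k in sequentially. P_word S \<mu> * v k - c *\<^sub>C v k = 0"
      unfolding eventually_sequentially by auto
    then have "(\<lambda>k. P_word S \<mu> * v k - c *\<^sub>C v k) \<longlonglongrightarrow> 0"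
      by (rule tendsto_eventually)
    then show ?thesis by (auto simp: A_def)
  qed
  \<comment> \<open>An asymptotic eigenvalue of \<open>d\<close> gives no direct control of
    \<open>star d\<close>, so closure under \<open>star\<close> is built in by intersecting with the
    preimage of \<open>A\<close>.\<close>
  have "closed (A \<inter> star -` A)"
    using \<open>closed A\<close>
    by (intro closed_Int closed_vimage bounded_linear.continuous_on[OF bounded_linear_star continuous_on_id])
  then have "cstar_subalgebra (A \<inter> star -` A)"
    using A_0 A_add A_mult A_scale
    by (auto simp: cstar_subalgebra_def star_add star_mult star_star star_scaleC)
  then have "d \<in> A \<inter> star -` A"
    by (rule diagonal_induct)
      (use assms A_P in \<open>auto simp: P_word_def star_mult star_star\<close>)
  then show ?thesis by (simp add: A_def v_def)
qed

text \<open>The elements satisfying the hypothesis form a closed two-sided ideal, because the set of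
  infinite words \<open>\<nu>jjj\<dots>\<close> is closed under adding and removing letters at the front.\<close>

lemma zero_if_asymptotically_zero:
  assumes j: "j \<in> {1..n}"
    and x: "\<And>\<nu>. \<nu> \<in> words n \<Longrightarrow> (\<lambda>k. x * S_word S \<nu> * S j ^ k) \<longlonglongrightarrow> 0"
  shows "x = 0"
proof -
  define N where "N = {x. \<forall>\<nu>\<in>words n. (\<lambda>k. x * S_word S \<nu> * S j ^ k) \<longlonglongrightarrow> 0}"
  have norm_pow: "norm (S j ^ k) = 1" for k
    using norm_S_word[of "replicate k j"] j by simp
  have "closed N"
    unfolding closed_sequential_limits
  proof (intro allI impI, elim conjE)
    fix X x assume X: "\<forall>m. X m \<in> N" and lim: "X \<longlonglongrightarrow> x"
    have "(\<lambda>k. x * S_word S \<nu> * S j ^ k) \<longlonglongrightarrow> 0" if \<nu>: "\<nu> \<in> words n" for \<nu>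
    proof (rule tendstoI)
      fix e :: real assume "e > 0"
      obtain m where m: "dist (X m) x < e/2"
        using tendstoD[OF lim, of "e/2"] \<open>e > 0\<close> eventually_happens trivial_limit_sequentially
        by (metis half_gt_zero)
      have "(\<lambda>k. X m * S_word S \<nu> * S j ^ k) \<longlonglongrightarrow> 0"
        using X \<nu> by (simp add: N_def)
      then have "\<forall>\<^sub>F k in sequentially. dist (X m * S_word S \<nu> * S j ^ k) 0 < e/2"
        using \<open>e > 0\<close> by (intro tendstoD) auto
      then show "\<forall>\<^sub>F k in sequentially. dist (x * S_word S \<nu> * S j ^ k) 0 < e"
      proof eventually_elim
        case (elim k)
        have "norm ((X m - x) * S_word S \<nu> * S j ^ k) \<le> norm (X m - x)"
          using norm_S_word[OF \<nu>] norm_pow[of k]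
          by (metis norm_mult_le_right order_refl order_trans)
        moreover have "x * S_word S \<nu> * S j ^ k = X m * S_word S \<nu> * S j ^ k - (X m - x) * S_word S \<nu> * S j ^ k"
          by (simp add: algebra_simps)
        ultimately have "norm (x * S_word S \<nu> * S j ^ k)
            \<le> norm (X m * S_word S \<nu> * S j ^ k) + norm (X m - x)"
          by (metis add_left_mono norm_triangle_ineq4 order_trans)
        then show ?case using elim m by (simp add: dist_norm)
      qed
    qed
    then show "x \<in> N" by (simp add: N_def)
  qed
  have N_0: "0 \<in> N" by (simp add: N_def)
  have N_add: "x + y \<in> N" if "x \<in> N" "y \<in> N" for x y
    using that by (auto simp: N_def distrib_right intro: tendsto_add_zero)
  have N_left: "y * x \<in> N" if "x \<in> N" for x y
    using that tendsto_mult_right_zero by (fastforce simp: N_def mult.assoc)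
  have N_scale: "c *\<^sub>C x \<in> N" if "x \<in> N" for c x
    using N_left[OF that, of "c *\<^sub>C 1"] by (simp add: scaleC_simps)
  have N_S: "x * S i \<in> N" if i: "i \<in> {1..n}" and "x \<in> N" for i x
    unfolding N_def
  proof (intro CollectI ballI)
    fix \<nu> assume "\<nu> \<in> words n"
    then have "i # \<nu> \<in> words n" using i by simp
    then have "(\<lambda>k. x * S_word S (i # \<nu>) * S j ^ k) \<longlonglongrightarrow> 0"
      using \<open>x \<in> N\<close> unfolding N_def by blast
    then show "(\<lambda>k. x * S i * S_word S \<nu> * S j ^ k) \<longlonglongrightarrow> 0"
      by (simp add: mult.assoc)
  qed
  have N_star_S: "x * star (S i) \<in> N" if i: "i \<in> {1..n}" and "x \<in> N" for i x
    unfolding N_def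
  proof (intro CollectI ballI)
    fix \<nu> assume \<nu>: "\<nu> \<in> words n"
    have x: "(\<lambda>k. x * S_word S \<mu> * S j ^ k) \<longlonglongrightarrow> 0" if "\<mu> \<in> words n" for \<mu>
      using \<open>x \<in> N\<close> that by (simp add: N_def)
    have eq: "x * star (S i) * (S l * y) = (if i = l then x * y else 0)" if "l \<in> {1..n}" for l y
    proof -
      have "x * star (S i) * (S l * y) = x * (star (S i) * S l * y)"
        by (simp only: mult.assoc)
      then show ?thesis using star_mult_generators[OF i that] by simp
    qed
    show "(\<lambda>k. x * star (S i) * S_word S \<nu> * S j ^ k) \<longlonglongrightarrow> 0"
    proof (cases \<nu>)
      case Nil
      \<comment> \<open>With no letter of \<nu> to cancel, \<open>star (S i)\<close> meets the first
        factor of the power of \<open>S j\<close>; this shifts the sequence by one, which does not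
        affect its limit.\<close>
      have shift: "x * star (S i) * S j ^ Suc k = (if i = j then x * S j ^ k else 0)" for k
        using eq[OF j] by simp
      have "(\<lambda>k. x * star (S i) * S j ^ Suc k) \<longlonglongrightarrow> 0"
        unfolding shift using x[of "[]"] by (cases "i = j") simp_all
      then show ?thesis
        unfolding Nil by (simp add: filterlim_sequentially_Suc[of "\<lambda>k. x * star (S i) * S j ^ k"] del: power_Suc)
    next
      case (Cons l \<mu>)
      then have "l \<in> {1..n}" "\<mu> \<in> words n" using \<nu> by auto
      then show ?thesis
        using x[of \<mu>] by (simp add: Cons eq mult.assoc[of _ "S l * _"])
    qed
  qed
  have N_right: "x * y \<in> N" if "x \<in> N" for x y
    using right_invariant_subspace[of N x y] \<open>closed N\<close> N_0 N_add N_scale N_S N_star_S that by blast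
  have "closed_ideal N"
    using \<open>closed N\<close> N_0 N_add N_scale N_left N_right by (simp add: closed_ideal_def)
  moreover have "1 \<notin> N"
  proof
    assume "1 \<in> N"
    then have "(\<lambda>k. 1 * S_word S [] * S j ^ k) \<longlonglongrightarrow> 0"
      unfolding N_def using words_simps(1) by blast
    then have "(\<lambda>k. norm (S j ^ k)) \<longlonglongrightarrow> 0"
      by (intro tendsto_norm_zero) simp
    then show False
      by (simp add: norm_pow LIMSEQ_const_iff)
  qed
  ultimately have "N = {0}"
    using simple by blast
  moreover have "x \<in> N" using x by (simp add: N_def)
  ultimately show ?thesis by simp
qed


end

section \<open>A unitary with a matrix row of entries of modulus below 1\<close>

locale non_monomial_row = cuntz_algebra n S for n and S :: "nat \<Rightarrow> 'a::cstar_algebra" +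
  fixes z :: 'a and Z :: "nat \<Rightarrow> nat \<Rightarrow> complex" and j :: nat
  assumes unitary: "star z * z = 1" "z * star z = 1"
    and coefficient: "i \<in> {1..n} \<Longrightarrow> l \<in> {1..n} \<Longrightarrow> star (S i) * z * S l = Z i l *\<^sub>C 1"
    and j: "j \<in> {1..n}"
    and row: "l \<in> {1..n} \<Longrightarrow> cmod (Z j l) < 1"
begin

definition T :: "nat \<Rightarrow> 'a" where "T i = z * S i"

text \<open>Through this, a product of an adjoint word in \<open>T\<close> with a word in
  \<open>S\<close> loses its innermost pair of letters at the price of a scalar.\<close>

lemma star_T_S:
  assumes "i \<in> {1..n}" and "l \<in> {1..n}"
  shows "star (T l) * S i = cnj (Z i l) *\<^sub>C 1"
  using arg_cong[OF coefficient[OF assms], of star]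
  by (simp add: T_def star_mult star_star star_scaleC mult.assoc)

text \<open>Inserting \<open>z * star z = 1\<close> and the sum of the range projections rewrites
  the adjoint generators in the adjoint \<open>T l\<close>. Multiplication by
  \<open>star (S i)\<close> thereby lengthens a \<open>T\<close>-word by one letter.\<close>

lemma star_S_eq:
  assumes "i \<in> {1..n}"
  shows "star (S i) = (\<Sum>l=1..n. Z i l *\<^sub>C star (T l))"
proof -
  have "star (S i) = star (S i) * z * (\<Sum>l=1..n. S l * star (S l)) * star z"
    unfolding sum_range_projections by (simp add: unitary mult.assoc)
  also have "\<dots> = (\<Sum>l=1..n. star (S i) * z * S l * (star (S l) * star z))"
    by (simp add: sum_distrib_left sum_distrib_right mult.assoc)
  also have "\<dots> = (\<Sum>l=1..n. Z i l *\<^sub>C star (T l))"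
    using coefficient[OF assms] by (intro sum.cong) (simp_all add: T_def star_mult scaleC_simps)
  finally show ?thesis .
qed

lemma sum_T: "(\<Sum>i=1..n. T i * (star (T i) * x)) = x"
proof -
  have "(\<Sum>i=1..n. T i * (star (T i) * x)) = z * (\<Sum>i=1..n. S i * (star (S i) * (star z * x)))"
    by (simp add: T_def star_mult sum_distrib_left mult.assoc)
  then show ?thesis
    unfolding sum_matrix_units by (simp add: unitary flip: mult.assoc)
qed

lemma T_word_isometry: "\<mu> \<in> words n \<Longrightarrow> star (S_word T \<mu>) * S_word T \<mu> = 1"
proof (induction \<mu>)
  case (Cons i \<mu>)
  have "star (S_word T (i # \<mu>)) * S_word T (i # \<mu>) =
      star (S_word T \<mu>) * (star (S i) * ((star z * z) * S i)) * S_word T \<mu>"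
    by (simp add: star_mult T_def mult.assoc)
  then show ?case
    using Cons isometry[of i] by (simp add: unitary)
qed simp

lemma norm_T_word: "\<mu> \<in> words n \<Longrightarrow> norm (S_word T \<mu>) = 1"
  by (intro norm_isometry T_word_isometry)

lemma norm_S_power: "norm (S j ^ k) = 1"
  using norm_S_word[of "replicate k j"] j by simp

lemma norm_coefficient_le_1:
  assumes "i \<in> {1..n}" and "l \<in> {1..n}"
  shows "cmod (Z i l) \<le> 1"
proof -
  have "norm (star (S i) * z * S l) \<le> 1"
    using norm_isometry[OF isometry] norm_isometry[OF unitary(1)] assms
    by (intro norm_mult_le_1) auto
  then show ?thesis
    unfolding coefficient[OF assms] by (simp add: norm_scaleC)
qed

text \<open>Each letter of \<mu> cancels one factor \<open>S j\<close> and contributes the conjugate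
  of an entry of row \<open>j\<close>; \<open>r\<close> is the largest modulus in that row. The
  condition \<open>length \<mu> \<le> k\<close> provides enough factors.\<close>

lemma star_T_word_power_decay:
  obtains r where "0 \<le> r" "r < 1"
    "\<And>\<mu> k. \<mu> \<in> words n \<Longrightarrow> length \<mu> \<le> k \<Longrightarrow> norm (star (S_word T \<mu>) * S j ^ k) \<le> r ^ length \<mu>"
proof -
  define r where "r = Max ((\<lambda>l. cmod (Z j l)) ` {1..n})"
  have ne: "(\<lambda>l. cmod (Z j l)) ` {1..n} \<noteq> {}" using j by auto
  have r1: "r < 1"
    unfolding r_def using row ne by (subst Max_less_iff) auto
  have le_r: "cmod (Z j l) \<le> r" if "l \<in> {1..n}" for l
    unfolding r_def using that by (intro Max_ge) auto
  have r0: "0 \<le> r"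
    using le_r[OF j] norm_ge_zero order_trans by blast
  have "norm (star (S_word T \<mu>) * S j ^ k) \<le> r ^ length \<mu>"
    if "\<mu> \<in> words n" "length \<mu> \<le> k" for \<mu> k
    using that
  proof (induction \<mu> arbitrary: k)
    case Nil
    then show ?case by (simp add: norm_S_power)
  next
    case (Cons l \<mu>)
    then obtain m where k: "k = Suc m" "length \<mu> \<le> m" by (cases k) auto
    have l: "l \<in> {1..n}" using Cons.prems by simp
    have "star (S_word T (l # \<mu>)) * S j ^ k = star (S_word T \<mu>) * ((star (T l) * S j) * S j ^ m)"
      by (simp add: k star_mult mult.assoc)
    also have "\<dots> = cnj (Z j l) *\<^sub>C (star (S_word T \<mu>) * S j ^ m)"
      unfolding star_T_S[OF j l] by (simp add: scaleC_simps)
    also have "norm \<dots> \<le> r * r ^ length \<mu>"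
      using Cons k le_r[OF l] r0 by (auto simp: norm_scaleC intro!: mult_mono)
    finally show ?case by simp
  qed
  then show ?thesis using that r0 r1 by blast
qed

text \<open>The elements \<open>x\<close> with this property are stable under left multiplication by \<open>S i\<close> and
  \<open>star (S i)\<close>, which merely remove or add a letter of \<open>\<mu>\<close>.\<close>

lemma star_T_word_decay:
  assumes "\<epsilon> > 0"
  shows "\<exists>K. \<forall>\<mu>\<in>words n. K \<le> length \<mu> \<longrightarrow>
    (\<forall>\<^sub>F k in sequentially. norm (star (S_word T \<mu>) * (x * S j ^ k)) \<le> \<epsilon>)"
proof -
  define ev where "ev x \<epsilon> \<mu> \<longleftrightarrow>
    (\<forall>\<^sub>F k in sequentially. norm (star (S_word T \<mu>) * (x * S j ^ k)) \<le> \<epsilon>)" for x \<epsilon> \<mu>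
  \<comment> \<open>The threshold \<open>K\<close> is uniform over all words, while the index from
    which the bound holds may depend on \<mu>.\<close>
  define M where "M = {x. \<forall>\<epsilon>>0. \<exists>K. \<forall>\<mu>\<in>words n. K \<le> length \<mu> \<longrightarrow> ev x \<epsilon> \<mu>}"
  have M_add: "x + y \<in> M" if "x \<in> M" "y \<in> M" for x y
    unfolding M_def
  proof (intro CollectI allI impI)
    fix \<epsilon> :: real assume "\<epsilon> > 0"
    then have "\<epsilon>/2 > 0" by simp
    then obtain K where K: "\<And>\<mu>. \<mu> \<in> words n \<Longrightarrow> K \<le> length \<mu> \<Longrightarrow> ev x (\<epsilon>/2) \<mu>"
      using \<open>x \<in> M\<close> unfolding M_def by blast
    obtain K' where K': "\<And>\<mu>. \<mu> \<in> words n \<Longrightarrow> K' \<le> length \<mu> \<Longrightarrow> ev y (\<epsilon>/2) \<mu>"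
      using \<open>y \<in> M\<close> \<open>\<epsilon>/2 > 0\<close> unfolding M_def by blast
    have "ev (x + y) \<epsilon> \<mu>" if "\<mu> \<in> words n" "max K K' \<le> length \<mu>" for \<mu>
    proof -
      have "ev x (\<epsilon>/2) \<mu>" "ev y (\<epsilon>/2) \<mu>" using that K K' by auto
      then show ?thesis
        unfolding ev_def
      proof eventually_elim
        case (elim k)
        then show ?case
          using norm_triangle_mono[OF elim] by (simp add: distrib_left distrib_right)
      qed
    qed
    then show "\<exists>K. \<forall>\<mu>\<in>words n. K \<le> length \<mu> \<longrightarrow> ev (x + y) \<epsilon> \<mu>" by blast
  qed
  have small: "norm (star (S_word T \<mu>) * (x * S j ^ k)) \<le> norm x" if "\<mu> \<in> words n" for \<mu> x k
    using norm_T_word[OF that] norm_S_power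
    by (intro order_trans[OF norm_mult_le_left norm_mult_le_right]) auto
  have "closed M"
    unfolding closed_sequential_limits
  proof (intro allI impI, elim conjE)
    fix X x assume X: "\<forall>m. X m \<in> M" and lim: "X \<longlonglongrightarrow> x"
    show "x \<in> M"
      unfolding M_def
    proof (intro CollectI allI impI)
      fix \<epsilon> :: real assume "\<epsilon> > 0"
      then have "\<epsilon>/2 > 0" by simp
      then obtain m where m: "dist (X m) x < \<epsilon>/2"
        using tendstoD[OF lim] eventually_happens trivial_limit_sequentially by blast
      obtain K where K: "\<And>\<mu>. \<mu> \<in> words n \<Longrightarrow> K \<le> length \<mu> \<Longrightarrow> ev (X m) (\<epsilon>/2) \<mu>"
        using X \<open>\<epsilon>/2 > 0\<close> unfolding M_def by blast
      have "ev x \<epsilon> \<mu>" if \<mu>: "\<mu> \<in> words n" "K \<le> length \<mu>" for \<mu>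
        using K[OF \<mu>] unfolding ev_def
      proof eventually_elim
        case (elim k)
        have "star (S_word T \<mu>) * (x * S j ^ k) =
            star (S_word T \<mu>) * (X m * S j ^ k) + star (S_word T \<mu>) * ((x - X m) * S j ^ k)"
          by (simp add: algebra_simps)
        also have "norm \<dots> \<le> \<epsilon>/2 + \<epsilon>/2"
          using elim small[OF \<mu>(1), of "x - X m" k] m
          by (intro norm_triangle_mono) (auto simp: dist_norm norm_minus_commute)
        finally show ?case by simp
      qed
      then show "\<exists>K. \<forall>\<mu>\<in>words n. K \<le> length \<mu> \<longrightarrow> ev x \<epsilon> \<mu>" by blast
    qed
  qed
  \<comment> \<open>The summand 1 in the denominator keeps it positive when
    \<open>c = 0\<close>.\<close>
  have ev_scale: "ev (c *\<^sub>C x) \<epsilon> \<mu>" if "ev x (\<epsilon> / (1 + cmod c)) \<mu>" for c x \<epsilon> \<mu>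
    using that unfolding ev_def
  proof eventually_elim
    case (elim k)
    then have "(1 + cmod c) * norm (star (S_word T \<mu>) * (x * S j ^ k)) \<le> \<epsilon>"
      by (simp add: pos_le_divide_eq add_pos_nonneg mult.commute)
    then show ?case
      by (simp add: scaleC_simps norm_scaleC distrib_right) (smt (verit) norm_ge_zero)
  qed
  have M_scale: "c *\<^sub>C x \<in> M" if "x \<in> M" for c x
    unfolding M_def
  proof (intro CollectI allI impI)
    fix \<epsilon> :: real assume "\<epsilon> > 0"
    then have "\<epsilon> / (1 + cmod c) > 0" by (simp add: add_pos_nonneg)
    then show "\<exists>K. \<forall>\<mu>\<in>words n. K \<le> length \<mu> \<longrightarrow> ev (c *\<^sub>C x) \<epsilon> \<mu>"
      using \<open>x \<in> M\<close> ev_scale unfolding M_def by blast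
  qed
  have M_S: "S i * x \<in> M" if i: "i \<in> {1..n}" and "x \<in> M" for i x
    unfolding M_def
  proof (intro CollectI allI impI)
    fix \<epsilon> :: real assume "\<epsilon> > 0"
    then obtain K where K: "\<And>\<mu>. \<mu> \<in> words n \<Longrightarrow> K \<le> length \<mu> \<Longrightarrow> ev x \<epsilon> \<mu>"
      using \<open>x \<in> M\<close> unfolding M_def by blast
    \<comment> \<open>One letter of \<mu> is spent on \<open>S i\<close>, so one more is
      required.\<close>
    have "ev (S i * x) \<epsilon> \<mu>" if \<mu>: "\<mu> \<in> words n" "Suc K \<le> length \<mu>" for \<mu>
    proof -
      obtain l \<nu> where \<nu>: "\<mu> = l # \<nu>" using \<mu> by (cases \<mu>) auto
      then have l: "l \<in> {1..n}" using \<mu> by simp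
      have "norm (star (S_word T \<mu>) * (S i * x * S j ^ k))
          \<le> norm (star (S_word T \<nu>) * (x * S j ^ k))" for k
      proof -
        have "star (S_word T \<mu>) * (S i * x * S j ^ k) =
            star (S_word T \<nu>) * ((star (T l) * S i) * (x * S j ^ k))"
          by (simp add: \<nu> star_mult mult.assoc)
        also have "\<dots> = cnj (Z i l) *\<^sub>C (star (S_word T \<nu>) * (x * S j ^ k))"
          unfolding star_T_S[OF i l] by (simp add: scaleC_simps)
        finally show ?thesis
          using norm_coefficient_le_1[OF i l] by (simp add: norm_scaleC mult_left_le_one_le)
      qed
      moreover have "ev x \<epsilon> \<nu>" using K \<mu> \<nu> by simp
      ultimately show ?thesis
        unfolding ev_def by (auto elim!: eventually_mono intro: order_trans)
    qed
    then show "\<exists>K. \<forall>\<mu>\<in>words n. K \<le> length \<mu> \<longrightarrow> ev (S i * x) \<epsilon> \<mu>" by blast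
  qed
  have M_star_S: "star (S i) * x \<in> M" if i: "i \<in> {1..n}" and "x \<in> M" for i x
    unfolding M_def
  proof (intro CollectI allI impI)
    fix \<epsilon> :: real assume "\<epsilon> > 0"
    \<comment> \<open>\<open>star (S i)\<close> expands into \<open>n\<close> terms with
      coefficients of modulus at most 1, each to be bounded by an \<open>n\<close>-th of \<epsilon>.
      The words \<open>l # \<mu>\<close> are longer than \<mu>, so the same \<open>K\<close>
      works.\<close>
    then have "\<epsilon> / n > 0" using n_ge_2 by simp
    then obtain K where K: "\<And>\<mu>. \<mu> \<in> words n \<Longrightarrow> K \<le> length \<mu> \<Longrightarrow> ev x (\<epsilon> / n) \<mu>"
      using \<open>x \<in> M\<close> unfolding M_def by blast
    have "ev (star (S i) * x) \<epsilon> \<mu>" if \<mu>: "\<mu> \<in> words n" "K \<le> length \<mu>" for \<mu>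
    proof -
      have "\<forall>\<^sub>F k in sequentially. \<forall>l\<in>{1..n}. norm (star (S_word T (l # \<mu>)) * (x * S j ^ k)) \<le> \<epsilon> / n"
        using K \<mu> by (intro eventually_ball_finite) (auto simp: ev_def simp del: S_word_simps)
      then show ?thesis
        unfolding ev_def
      proof eventually_elim
        case (elim k)
        have "star (S_word T \<mu>) * (star (S i) * x * S j ^ k) =
            (\<Sum>l=1..n. Z i l *\<^sub>C (star (S_word T (l # \<mu>)) * (x * S j ^ k)))"
          by (simp add: star_S_eq[OF i] sum_distrib_left sum_distrib_right star_mult scaleC_simps mult.assoc)
        also have "norm \<dots> \<le> (\<Sum>l=1..n. \<epsilon> / n)"
        proof (rule sum_norm_le)
          fix l assume l: "l \<in> {1..n}"
          have "norm (Z i l *\<^sub>C (star (S_word T (l # \<mu>)) * (x * S j ^ k))) \<le>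
              norm (star (S_word T (l # \<mu>)) * (x * S j ^ k))"
            using norm_coefficient_le_1[OF i l] by (simp only: norm_scaleC) (simp add: mult_left_le_one_le)
          then show "norm (Z i l *\<^sub>C (star (S_word T (l # \<mu>)) * (x * S j ^ k))) \<le> \<epsilon> / n"
            using elim l by (meson order_trans)
        qed
        finally show ?case using n_ge_2 by simp
      qed
    qed
    then show "\<exists>K. \<forall>\<mu>\<in>words n. K \<le> length \<mu> \<longrightarrow> ev (star (S i) * x) \<epsilon> \<mu>" by blast
  qed
  have M_1: "1 \<in> M"
    unfolding M_def
  proof (intro CollectI allI impI)
    fix \<epsilon> :: real assume "\<epsilon> > 0"
    obtain r where r: "0 \<le> r" "r < 1"
      "\<And>\<mu> k. \<mu> \<in> words n \<Longrightarrow> length \<mu> \<le> k \<Longrightarrow> norm (star (S_word T \<mu>) * S j ^ k) \<le> r ^ length \<mu>"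
      using star_T_word_power_decay by blast
    then obtain K where K: "r ^ K < \<epsilon>"
      using real_arch_pow_inv[OF \<open>\<epsilon> > 0\<close>] by blast
    have "ev 1 \<epsilon> \<mu>" if \<mu>: "\<mu> \<in> words n" "K \<le> length \<mu>" for \<mu>
    proof -
      have "r ^ length \<mu> \<le> \<epsilon>"
        using power_decreasing[OF \<mu>(2), of r] r K by simp
      then have "\<forall>k\<ge>length \<mu>. norm (star (S_word T \<mu>) * S j ^ k) \<le> \<epsilon>"
        using r(3)[OF \<mu>(1)] order_trans by blast
      then show ?thesis
        unfolding ev_def eventually_sequentially by auto
    qed
    then show "\<exists>K. \<forall>\<mu>\<in>words n. K \<le> length \<mu> \<longrightarrow> ev 1 \<epsilon> \<mu>" by blast
  qed
  have "0 \<in> M" using M_scale[OF M_1, of 0] by simp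
  then have "x * 1 \<in> M"
    using left_invariant_subspace[of M 1 x] \<open>closed M\<close> M_add M_scale M_S M_star_S M_1 by blast
  then show ?thesis
    using assms by (auto simp: M_def ev_def)
qed

lemma intertwiner_zero:
  assumes a: "\<And>\<mu>. \<mu> \<in> words n \<Longrightarrow> \<exists>d\<in>\<D> n S. P_word T \<mu> * a = a * d"
  shows "a = 0"
proof (rule zero_if_asymptotically_zero[OF j])
  fix \<nu> assume \<nu>: "\<nu> \<in> words n"
  define y where "y k = a * (S_word S \<nu> * S j ^ k)" for k
  have "y \<longlonglongrightarrow> 0"
  proof (rule ccontr)
    assume y: "\<not> y \<longlonglongrightarrow> 0"
    \<comment> \<open>Right multiplication by an isometry does not increase the norm, so the norms
      decrease to a limit \<open>L\<close>, which is also a lower bound; it is positive since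
      \<open>y\<close> does not tend to 0.\<close>
    have "y (Suc k) = y k * S j" for k
      by (simp add: y_def mult.assoc power_Suc2 del: power_Suc)
    then have "decseq (\<lambda>k. norm (y k))"
      using norm_isometry[OF isometry[OF j]]
      by (auto intro!: decseq_SucI norm_mult_le_right)
    moreover obtain L where L: "(\<lambda>k. norm (y k)) \<longlonglongrightarrow> L"
      using decseq_convergent[OF calculation, of 0] by auto
    ultimately have y_ge: "L \<le> norm (y k)" for k
      by (rule decseq_ge)
    have "L \<ge> 0"
      using L by (rule LIMSEQ_le_const) simp
    moreover have "L \<noteq> 0"
      using L y tendsto_norm_zero_iff by blast
    ultimately have "L > 0" by simp
    \<comment> \<open>The projection of \<mu> is the sum of those of its one-letter extensions, so
      at least one extension inherits the failure to tend to 0.\<close>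
    have big: "\<exists>\<mu>\<in>words n. length \<mu> = K \<and> \<not> (\<lambda>k. P_word T \<mu> * y k) \<longlonglongrightarrow> 0" for K
    proof (induction K)
      case 0
      then show ?case using y by (intro bexI[of _ "[]"]) (auto simp: P_word_def)
    next
      case (Suc K)
      then obtain \<mu> where \<mu>: "\<mu> \<in> words n" "length \<mu> = K" "\<not> (\<lambda>k. P_word T \<mu> * y k) \<longlonglongrightarrow> 0"
        by blast
      have split: "P_word T \<mu> * x = (\<Sum>i=1..n. P_word T (\<mu> @ [i]) * x)" for x
      proof -
        have "(\<Sum>i=1..n. P_word T (\<mu> @ [i]) * x) =
            S_word T \<mu> * (\<Sum>i=1..n. T i * (star (T i) * (star (S_word T \<mu>) * x)))"
          by (simp add: P_word_def star_mult sum_distrib_left mult.assoc)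
        then show ?thesis
          unfolding sum_T by (simp add: P_word_def mult.assoc)
      qed
      have "\<not> (\<forall>i\<in>{1..n}. (\<lambda>k. P_word T (\<mu> @ [i]) * y k) \<longlonglongrightarrow> 0)"
      proof
        assume "\<forall>i\<in>{1..n}. (\<lambda>k. P_word T (\<mu> @ [i]) * y k) \<longlonglongrightarrow> 0"
        then have "(\<lambda>k. \<Sum>i=1..n. P_word T (\<mu> @ [i]) * y k) \<longlonglongrightarrow> 0"
          by (intro tendsto_null_sum) blast
        then show False
          using \<mu>(3) unfolding split[symmetric] by contradiction
      qed
      then obtain i where "i \<in> {1..n}" "\<not> (\<lambda>k. P_word T (\<mu> @ [i]) * y k) \<longlonglongrightarrow> 0"
        by blast
      then show ?case
        using \<mu> by (intro bexI[of _ "\<mu> @ [i]"]) auto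
    qed
    \<comment> \<open>The final estimate is
      \<open>norm (y k) \<le> norm (Q * y k) + norm (Q * y k - y k)\<close>, with each summand at
      most \<open>L / 3\<close>; this contradicts the lower bound \<open>L\<close>.\<close>
    obtain K where K: "\<And>\<mu>. \<mu> \<in> words n \<Longrightarrow> K \<le> length \<mu> \<Longrightarrow>
        \<forall>\<^sub>F k in sequentially. norm (star (S_word T \<mu>) * (a * S_word S \<nu> * S j ^ k)) \<le> L / 3"
      using star_T_word_decay[of "L / 3" "a * S_word S \<nu>"] \<open>L > 0\<close> by auto
    obtain \<mu> where \<mu>: "\<mu> \<in> words n" "length \<mu> = K" and Qy: "\<not> (\<lambda>k. P_word T \<mu> * y k) \<longlonglongrightarrow> 0"
      using big by blast
    define Q where "Q = P_word T \<mu>"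
    have QQ: "Q * (Q * x) = Q * x" for x
    proof -
      have "Q * (Q * x) = S_word T \<mu> * ((star (S_word T \<mu>) * S_word T \<mu>) * (star (S_word T \<mu>) * x))"
        by (simp only: Q_def P_word_def mult.assoc)
      then show ?thesis
        by (simp add: T_word_isometry[OF \<mu>(1)] Q_def P_word_def mult.assoc)
    qed
    obtain d where d: "d \<in> \<D> n S" "Q * a = a * d"
      using a[OF \<mu>(1)] by (auto simp: Q_def)
    obtain c where "(\<lambda>k. d * (S_word S \<nu> * S j ^ k) - c *\<^sub>C (S_word S \<nu> * S j ^ k)) \<longlonglongrightarrow> 0"
      using diagonal_asymptotic_character[OF \<nu> j d(1)] by blast
    then have "(\<lambda>k. a * (d * (S_word S \<nu> * S j ^ k) - c *\<^sub>C (S_word S \<nu> * S j ^ k))) \<longlonglongrightarrow> 0"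
      by (rule tendsto_mult_right_zero)
    \<comment> \<open>The intertwining relation carries the asymptotic eigenvalue of
      \<open>d\<close> over to \<open>Q\<close>.\<close>
    moreover have "a * (d * x - c *\<^sub>C x) = Q * (a * x) - c *\<^sub>C (a * x)" for x
      by (simp add: right_diff_distrib scaleC_simps d flip: mult.assoc)
    ultimately have e: "(\<lambda>k. Q * y k - c *\<^sub>C y k) \<longlonglongrightarrow> 0"
      by (simp add: y_def)
    \<comment> \<open>\<open>Q\<close> is idempotent, hence so is its asymptotic eigenvalue \<open>c\<close>.\<close>
    have "c = 1"
    proof (rule ccontr)
      assume "c \<noteq> 1"
      \<comment> \<open>Applying \<open>Q\<close> produces the factor \<open>1 - c\<close>; dividing
        by it would make \<open>Q * y k\<close> tend to 0, against the choice of \<mu>. This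
        excludes \<open>c = 0\<close> too.\<close>
      have "(\<lambda>k. Q * (Q * y k - c *\<^sub>C y k)) \<longlonglongrightarrow> 0"
        using e by (rule tendsto_mult_right_zero)
      then have "(\<lambda>k. inverse (1 - c) *\<^sub>C (Q * (Q * y k - c *\<^sub>C y k))) \<longlonglongrightarrow> 0"
        by (rule tendsto_scaleC_zero)
      moreover have "inverse (1 - c) *\<^sub>C (Q * (Q * x - c *\<^sub>C x)) = Q * x" for x
      proof -
        have "Q * (Q * x - c *\<^sub>C x) = (1 - c) *\<^sub>C (Q * x)"
          by (simp add: right_diff_distrib QQ scaleC_simps complex_vector.scale_left_diff_distrib)
        then show ?thesis using \<open>c \<noteq> 1\<close> by (simp add: scaleC_simps)
      qed
      ultimately show False using Qy by (simp add: Q_def)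
    qed
    then have "\<forall>\<^sub>F k in sequentially. norm (Q * y k - y k) < L / 3"
      using tendstoD[OF e, of "L / 3"] \<open>L > 0\<close> by (simp add: scaleC_simps)
    moreover have "\<forall>\<^sub>F k in sequentially. norm (star (S_word T \<mu>) * (a * S_word S \<nu> * S j ^ k)) \<le> L / 3"
      using K \<mu> by simp
    ultimately have "\<forall>\<^sub>F k in sequentially. False"
    proof eventually_elim
      case (elim k)
      have "Q * y k = S_word T \<mu> * (star (S_word T \<mu>) * (a * S_word S \<nu> * S j ^ k))"
        by (simp add: Q_def P_word_def y_def mult.assoc)
      then have "norm (Q * y k) \<le> L / 3"
        using norm_T_word[OF \<mu>(1)] elim(2) by (metis norm_mult_le_left order_refl order_trans)
      moreover have "norm (y k) \<le> norm (Q * y k) + norm (Q * y k - y k)"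
        using norm_triangle_ineq4[of "Q * y k" "Q * y k - y k"] by simp
      ultimately show False
        using elim(1) y_ge[of k] \<open>L > 0\<close> by simp
    qed
    then show False by simp
  qed
  then show "(\<lambda>k. a * S_word S \<nu> * S j ^ k) \<longlonglongrightarrow> 0"
    unfolding y_def by (simp add: mult.assoc)
qed

end

section \<open>Finding the non-monomial row and conclusion\<close>

theorem theorem3p7:
  fixes n :: nat and S :: "nat \<Rightarrow> 'a::cstar_algebra"
    and z :: 'a and lambda_z :: "'a \<Rightarrow> 'a"
  assumes "cuntz_algebra n S"
    and "z \<in> unitaries (\<F> n S 1) - normalizer (\<F> n S 1) (diagonal_level n S 1)"
    and "is_cuntz_endomorphism n S z lambda_z"
  shows "(\<forall>a. (\<lambda>x. x * a) ` (lambda_z ` \<D> n S) = (\<lambda>x. a * x) ` \<D> n S \<longrightarrow> a = 0)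
    \<and> \<not> (\<exists>u \<in> unitaries UNIV. lambda_z ` \<D> n S = Ad u ` \<D> n S)"
proof -
  interpret cuntz_algebra n S by fact
  have z: "z \<in> \<F> n S 1" "star z * z = 1" "z * star z = 1"
    and not_norm: "z \<notin> normalizer (\<F> n S 1) (diagonal_level n S 1)"
    and zU: "z \<in> unitaries (\<F> n S 1)"
    using assms(2) by (auto simp: unitaries_def)
  have "\<exists>Z. \<forall>i\<in>{1..n}. \<forall>l\<in>{1..n}. star (S i) * z * S l = Z i l *\<^sub>C 1"
    using matrix_level_1_coefficient[OF z(1)] by metis
  then obtain Z where Z: "\<And>i l. i \<in> {1..n} \<Longrightarrow> l \<in> {1..n} \<Longrightarrow> star (S i) * z * S l = Z i l *\<^sub>C 1"
    by blast
  have star_z: "star z * S i = (\<Sum>l=1..n. cnj (Z i l) *\<^sub>C S l)" if i: "i \<in> {1..n}" for i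
  proof -
    have "star z * S i = (\<Sum>l=1..n. S l * (star (S l) * (star z * S i)))"
      by (simp only: sum_matrix_units)
    also have "\<dots> = (\<Sum>l=1..n. S l * star (star (S i) * z * S l))"
      by (simp add: star_mult star_star mult.assoc)
    also have "\<dots> = (\<Sum>l=1..n. cnj (Z i l) *\<^sub>C S l)"
      using Z[OF i] by (intro sum.cong) (simp_all add: star_scaleC scaleC_simps)
    finally show ?thesis .
  qed
  \<comment> \<open>Compressing \<open>z * star z = 1\<close> by \<open>S i\<close> shows that the
    rows of \<open>Z\<close> are unit vectors.\<close>
  have row_norm: "(\<Sum>l=1..n. (cmod (Z i l))\<^sup>2) = 1" if i: "i \<in> {1..n}" for i
  proof -
    have "1 = star (S i) * (z * star z) * S i"
      by (simp add: z isometry[OF i])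
    also have "\<dots> = star (S i) * z * (star z * S i)"
      by (simp only: mult.assoc)
    also have "\<dots> = (\<Sum>l=1..n. cnj (Z i l) *\<^sub>C (star (S i) * z * S l))"
      by (simp add: star_z[OF i] sum_distrib_left scaleC_simps)
    also have "\<dots> = (\<Sum>l=1..n. complex_of_real ((cmod (Z i l))\<^sup>2) *\<^sub>C 1)"
      using Z[OF i] by (intro sum.cong) (simp_all add: scaleC_simps mult.commute flip: complex_norm_square)
    also have "\<dots> = (\<Sum>l=1..n. (cmod (Z i l))\<^sup>2) *\<^sub>R 1"
      by (simp only: scaleR_sum_left scaleR_scaleC[symmetric])
    finally have "(1 - (\<Sum>l=1..n. (cmod (Z i l))\<^sup>2)) *\<^sub>R (1::'a) = 0"
      by (simp add: scaleR_left_diff_distrib)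
    then show ?thesis by simp
  qed
  \<comment> \<open>Otherwise every row has an entry of modulus at least 1. As the row is a unit
    vector, its other entries vanish, so \<open>z\<close> is monomial and normalizes the
    diagonal.\<close>
  have "\<exists>j\<in>{1..n}. \<forall>l\<in>{1..n}. cmod (Z j l) < 1"
  proof (rule ccontr)
    assume "\<not> ?thesis"
    then obtain \<sigma> where \<sigma>: "\<And>i. i \<in> {1..n} \<Longrightarrow> \<sigma> i \<in> {1..n} \<and> 1 \<le> cmod (Z i (\<sigma> i))"
      by (metis linorder_not_less)
    have "star z * S i = cnj (Z i (\<sigma> i)) *\<^sub>C S (\<sigma> i)" if i: "i \<in> {1..n}" for i
    proof -
      let ?A = "{1..n} - {\<sigma> i}"
      have "(cmod (Z i (\<sigma> i)))\<^sup>2 + (\<Sum>l\<in>?A. (cmod (Z i l))\<^sup>2) = 1"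
        unfolding row_norm[OF i, symmetric] using \<sigma>[OF i] by (intro sum.remove[symmetric]) auto
      moreover have "1 \<le> (cmod (Z i (\<sigma> i)))\<^sup>2"
        using \<sigma>[OF i] by (simp add: one_le_power)
      ultimately have "(\<Sum>l\<in>?A. (cmod (Z i l))\<^sup>2) = 0"
        using sum_nonneg[of ?A "\<lambda>l. (cmod (Z i l))\<^sup>2"] by auto
      then have "\<forall>l\<in>?A. Z i l = 0"
        by (subst (asm) sum_nonneg_eq_0_iff) auto
      then have "(\<Sum>l\<in>?A. cnj (Z i l) *\<^sub>C S l) = 0"
        by (intro sum.neutral) (simp add: scaleC_simps)
      moreover have "(\<Sum>l=1..n. cnj (Z i l) *\<^sub>C S l) =
          cnj (Z i (\<sigma> i)) *\<^sub>C S (\<sigma> i) + (\<Sum>l\<in>?A. cnj (Z i l) *\<^sub>C S l)"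
        using \<sigma>[OF i] by (intro sum.remove) auto
      ultimately show ?thesis
        unfolding star_z[OF i] by simp
    qed
    then have "z \<in> normalizer (\<F> n S 1) (diagonal_level n S 1)"
      using \<sigma> by (intro normalizer_if_monomial[OF zU, of \<sigma> "\<lambda>i. cnj (Z i (\<sigma> i))"]) simp_all
    then show False
      using not_norm by contradiction
  qed
  then obtain j where j: "j \<in> {1..n}" "\<forall>l\<in>{1..n}. cmod (Z j l) < 1"
    by blast
  interpret non_monomial_row n S z Z j
    by unfold_locales (use z Z j in auto)
  have lam: "lambda_z 1 = 1" "lambda_z (x * y) = lambda_z x * lambda_z y"
    "lambda_z (star x) = star (lambda_z x)" "i \<in> {1..n} \<Longrightarrow> lambda_z (S i) = T i" for x y i
    using assms(3) by (auto simp: is_cuntz_endomorphism_def unital_star_endomorphism_def T_def)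
  have "lambda_z (S_word S \<mu>) = S_word T \<mu>" if "\<mu> \<in> words n" for \<mu>
    using that by (induction \<mu>) (auto simp: lam)
  then have lam_P: "lambda_z (P_word S \<mu>) = P_word T \<mu>" if "\<mu> \<in> words n" for \<mu>
    using that by (simp add: P_word_def lam)
  have zero: "a = 0" if a: "(\<lambda>x. x * a) ` (lambda_z ` \<D> n S) = (\<lambda>x. a * x) ` \<D> n S" for a
  proof (rule intertwiner_zero)
    fix \<mu> assume \<mu>: "\<mu> \<in> words n"
    have "P_word T \<mu> * a \<in> (\<lambda>x. x * a) ` (lambda_z ` \<D> n S)"
      using P_word_in_diagonal[OF \<mu>] lam_P[OF \<mu>] by (metis imageI)
    then show "\<exists>d\<in>\<D> n S. P_word T \<mu> * a = a * d"
      unfolding a by blast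
  qed
  \<comment> \<open>Multiplying \<open>Ad u x\<close> by \<open>u\<close> on the right gives
    \<open>u * x\<close>, so \<open>u\<close> would itself satisfy the hypothesis on
    \<open>a\<close> and be 0.\<close>
  have "\<not> lambda_z ` \<D> n S = Ad u ` \<D> n S" if u: "u \<in> unitaries UNIV" for u
  proof
    assume eq: "lambda_z ` \<D> n S = Ad u ` \<D> n S"
    have uu: "star u * u = 1" using u by (simp add: unitaries_def)
    then have "Ad u x * u = u * x" for x
      by (simp add: Ad_def mult.assoc)
    then have "u = 0"
      by (intro zero) (simp add: eq image_image)
    then show False using uu by simp
  qed
  then show ?thesis using zero by blast
qed

end
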